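(* Let $A$ be a finite abelian group of even order and exponent at least $3$, let $y\in A$ have order $2$, and let $G=\mathrm{Dic}(A,y)=\langle A,x \mid x^2=y,\ xax^{-1}=a^{-1}\ (a\in A)\rangle$. Let $S\subseteq G$ with $1\notin S$, $S^{-1}=S$ and $\langle S\rangle=G$, write $S=S_1\cup xS_2$ with $S_1,S_2\subseteq A$, and assume $S_2^{-1}=S_2$. Then $\mathrm{Cay}(G,S)$ is distance integral if and only if $\mathrm{Cay}(G,S)$ is integral.
   Context: The Cayley graph $\mathrm{Cay}(G,S)$ has vertex set $G$ and edges $\{g,h\}$ with $g^{-1}h\in S$. A graph is integral if all eigenvalues of its adjacency matrix are integers; a connected graph is distance integral if all eigenvalues of its distance matrix are integers. *)

theory Defs
  imports "HOL-Algebra.Multiplicative_Group" "HOL-Algebra.Generated_Groups"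
    "Jordan_Normal_Form.Char_Poly"
begin

subsection \<open>Finite simple graphs and integrality\<close>

record 'v sgraph =
  vertices :: "'v set"
  edges :: "'v set set"

definition is_walk :: "'v sgraph \<Rightarrow> 'v \<Rightarrow> 'v list \<Rightarrow> 'v \<Rightarrow> bool" where
  "is_walk \<Gamma> u p v \<longleftrightarrow> p \<noteq> [] \<and> set p \<subseteq> vertices \<Gamma> \<and> hd p = u \<and> last p = v \<and>
     successively (\<lambda>a b. {a, b} \<in> edges \<Gamma>) p"

definition connected_sgraph :: "'v sgraph \<Rightarrow> bool" where
  "connected_sgraph \<Gamma> \<longleftrightarrow> vertices \<Gamma> \<noteq> {} \<and>
     (\<forall>u\<in>vertices \<Gamma>. \<forall>v\<in>vertices \<Gamma>. \<exists>p. is_walk \<Gamma> u p v)"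

text \<open>A walk is the list of its vertices, so its length as a walk is one less than the length
  of the list. The value is unspecified when no walk exists.\<close>

definition graph_dist :: "'v sgraph \<Rightarrow> 'v \<Rightarrow> 'v \<Rightarrow> nat" where
  "graph_dist \<Gamma> u v = (LEAST n. \<exists>p. is_walk \<Gamma> u p v \<and> length p = Suc n)"

text \<open>Matrices indexed by a finite set are turned into matrices indexed by natural numbers through
  an arbitrary enumeration; \<open>eigenvalue_matrix_on\<close> shows that the spectrum does not
  depend on it.\<close>

definition enumeration :: "'v set \<Rightarrow> 'v list" where
  "enumeration V = (SOME vs. set vs = V \<and> distinct vs)"

definition matrix_on :: "'v set \<Rightarrow> ('v \<Rightarrow> 'v \<Rightarrow> complex) \<Rightarrow> complex mat" where
  "matrix_on V f = mat (card V) (card V) (\<lambda>(i, j). f (enumeration V ! i) (enumeration V ! j))"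

definition adjacency_matrix :: "'v sgraph \<Rightarrow> complex mat" where
  "adjacency_matrix \<Gamma> = matrix_on (vertices \<Gamma>) (\<lambda>u v. if {u, v} \<in> edges \<Gamma> then 1 else 0)"

definition distance_matrix :: "'v sgraph \<Rightarrow> complex mat" where
  "distance_matrix \<Gamma> = matrix_on (vertices \<Gamma>) (\<lambda>u v. of_nat (graph_dist \<Gamma> u v))"

definition integral_graph :: "'v sgraph \<Rightarrow> bool" where
  "integral_graph \<Gamma> \<longleftrightarrow> (\<forall>k. eigenvalue (adjacency_matrix \<Gamma>) k \<longrightarrow> k \<in> \<int>)"

definition distance_integral_graph :: "'v sgraph \<Rightarrow> bool" where
  "distance_integral_graph \<Gamma> \<longleftrightarrow>
     connected_sgraph \<Gamma> \<and> (\<forall>k. eigenvalue (distance_matrix \<Gamma>) k \<longrightarrow> k \<in> \<int>)"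

lemma enumeration:
  assumes "finite V"
  shows "set (enumeration V) = V" "distinct (enumeration V)" "length (enumeration V) = card V"
proof -
  have "set (enumeration V) = V \<and> distinct (enumeration V)"
    unfolding enumeration_def by (rule someI_ex) (rule finite_distinct_list[OF assms])
  then show "set (enumeration V) = V" "distinct (enumeration V)"
    "length (enumeration V) = card V"
    using distinct_card by fastforce+
qed

lemma eigenvalue_matrix_on:
  assumes V: "finite V"
  shows "eigenvalue (matrix_on V f) k \<longleftrightarrow>
    (\<exists>h. (\<exists>v\<in>V. h v \<noteq> 0) \<and> (\<forall>u\<in>V. (\<Sum>v\<in>V. f u v * h v) = k * h u))"
proof -
  let ?e = "\<lambda>i. enumeration V ! i" and ?n = "card V"
  have bij: "bij_betw ?e {..<?n} V"
    using bij_betw_nth[OF enumeration(2)[OF V]] enumeration[OF V] by simp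
  have eV: "?e i \<in> V" if "i < ?n" for i
    using bij that by (auto dest: bij_betwE)
  have sum: "(\<Sum>v\<in>V. g v) = (\<Sum>i<?n. g (?e i))" for g :: "_ \<Rightarrow> complex"
    using sum.reindex_bij_betw[OF bij] by metis
  have all: "(\<forall>u\<in>V. P u) \<longleftrightarrow> (\<forall>i<?n. P (?e i))" for P
    using bij unfolding bij_betw_def by (metis imageE imageI lessThan_iff)
  have ex: "(\<exists>u\<in>V. P u) \<longleftrightarrow> (\<exists>i<?n. P (?e i))" for P
    using bij unfolding bij_betw_def by (metis imageE imageI lessThan_iff)
  have mult: "matrix_on V f *\<^sub>v w = k \<cdot>\<^sub>v w \<longleftrightarrow>
      (\<forall>i<?n. (\<Sum>j<?n. f (?e i) (?e j) * w $ j) = k * w $ i)"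
    if "w \<in> carrier_vec ?n" for w
    using that by (auto simp: matrix_on_def vec_eq_iff scalar_prod_def lessThan_atLeast0)
  have dim: "dim_row (matrix_on V f) = ?n" by (simp add: matrix_on_def)
  show ?thesis
  proof
    assume "eigenvalue (matrix_on V f) k"
    then obtain w where w: "w \<in> carrier_vec ?n" "w \<noteq> 0\<^sub>v ?n" "matrix_on V f *\<^sub>v w = k \<cdot>\<^sub>v w"
      by (auto simp: eigenvalue_def eigenvector_def dim)
    define h where "h = (\<lambda>v. w $ inv_into {..<?n} ?e v)"
    have h: "h (?e i) = w $ i" if "i < ?n" for i
      using that bij by (simp add: h_def bij_betw_def)
    have "\<exists>v\<in>V. h v \<noteq> 0"
      using w(1,2) h by (auto simp: ex vec_eq_iff)
    moreover have "\<forall>u\<in>V. (\<Sum>v\<in>V. f u v * h v) = k * h u"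
      using w mult[OF w(1)] h by (simp add: all sum)
    ultimately show "\<exists>h. (\<exists>v\<in>V. h v \<noteq> 0) \<and> (\<forall>u\<in>V. (\<Sum>v\<in>V. f u v * h v) = k * h u)"
      by blast
  next
    assume "\<exists>h. (\<exists>v\<in>V. h v \<noteq> 0) \<and> (\<forall>u\<in>V. (\<Sum>v\<in>V. f u v * h v) = k * h u)"
    then obtain h where h: "\<exists>v\<in>V. h v \<noteq> 0" "\<forall>u\<in>V. (\<Sum>v\<in>V. f u v * h v) = k * h u"
      by blast
    define w where "w = vec ?n (\<lambda>i. h (?e i))"
    have "w \<in> carrier_vec ?n" by (simp add: w_def)
    moreover have "w \<noteq> 0\<^sub>v ?n"
      using h(1) by (auto simp: ex w_def vec_eq_iff)
    moreover have "matrix_on V f *\<^sub>v w = k \<cdot>\<^sub>v w"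
      using h(2) mult[OF calculation(1)] by (simp add: all sum w_def)
    ultimately show "eigenvalue (matrix_on V f) k"
      by (auto simp: eigenvalue_def eigenvector_def dim)
  qed
qed


subsection \<open>Group presentations\<close>

text \<open>The letter \<open>(g, True)\<close> stands for the generator \<open>g\<close> and \<open>(g, False)\<close> for its formal
  inverse; a relation \<open>(l, r)\<close> stands for the equation \<open>l = r\<close>.\<close>

type_synonym 'g gword = "('g \<times> bool) list"

definition gwords :: "'g set \<Rightarrow> 'g gword set" where
  "gwords X = {w. fst ` set w \<subseteq> X}"

inductive pres_eq :: "'g set \<Rightarrow> ('g gword \<times> 'g gword) set \<Rightarrow> 'g gword \<Rightarrow> 'g gword \<Rightarrow> bool"
  for X R where
  refl: "w \<in> gwords X \<Longrightarrow> pres_eq X R w w"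
| sym: "pres_eq X R v w \<Longrightarrow> pres_eq X R w v"
| trans: "pres_eq X R u v \<Longrightarrow> pres_eq X R v w \<Longrightarrow> pres_eq X R u w"
| cancel: "g \<in> X \<Longrightarrow> u \<in> gwords X \<Longrightarrow> v \<in> gwords X \<Longrightarrow>
    pres_eq X R (u @ [(g, b), (g, \<not> b)] @ v) (u @ v)"
| relation: "(l, r) \<in> R \<Longrightarrow> l \<in> gwords X \<Longrightarrow> r \<in> gwords X \<Longrightarrow>
    u \<in> gwords X \<Longrightarrow> v \<in> gwords X \<Longrightarrow> pres_eq X R (u @ l @ v) (u @ r @ v)"

definition pres_class :: "'g set \<Rightarrow> ('g gword \<times> 'g gword) set \<Rightarrow> 'g gword \<Rightarrow> 'g gword set" where
  "pres_class X R w = {v. pres_eq X R w v}"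

definition presented_group :: "'g set \<Rightarrow> ('g gword \<times> 'g gword) set \<Rightarrow> 'g gword set monoid" where
  "presented_group X R =
     \<lparr>carrier = pres_class X R ` gwords X,
      monoid.mult = (\<lambda>P Q. {w. \<exists>u\<in>P. \<exists>v\<in>Q. pres_eq X R (u @ v) w}),
      one = pres_class X R []\<rparr>"

lemma gwords_simps [simp]:
  "[] \<in> gwords X"
  "(g, b) # w \<in> gwords X \<longleftrightarrow> g \<in> X \<and> w \<in> gwords X"
  "u @ v \<in> gwords X \<longleftrightarrow> u \<in> gwords X \<and> v \<in> gwords X"
  by (auto simp: gwords_def)

lemma pres_eq_gwords:
  "pres_eq X R u v \<Longrightarrow> u \<in> gwords X \<and> v \<in> gwords X"
  by (induction rule: pres_eq.induct) auto

lemma pres_eq_append_left: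
  assumes "pres_eq X R u v" "w \<in> gwords X"
  shows "pres_eq X R (w @ u) (w @ v)"
  using assms
proof (induction rule: pres_eq.induct)
  case (cancel g u v b)
  then show ?case using pres_eq.cancel[of g X "w @ u" v R b] by simp
next
  case (relation l r u v)
  then show ?case using pres_eq.relation[of l r R X "w @ u" v] by simp
qed (auto intro: pres_eq.intros)

lemma pres_eq_append_right:
  assumes "pres_eq X R u v" "w \<in> gwords X"
  shows "pres_eq X R (u @ w) (v @ w)"
  using assms
proof (induction rule: pres_eq.induct)
  case (cancel g u v b)
  then show ?case using pres_eq.cancel[of g X u "v @ w" R b] by simp
next
  case (relation l r u v)
  then show ?case using pres_eq.relation[of l r R X u "v @ w"] by simp
qed (auto intro: pres_eq.intros)

lemma pres_eq_append:
  assumes "pres_eq X R u u'" "pres_eq X R v v'"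
  shows "pres_eq X R (u @ v) (u' @ v')"
  using assms pres_eq_append_left pres_eq_append_right pres_eq_gwords pres_eq.trans by metis

lemma pres_class_eq_iff:
  assumes "u \<in> gwords X"
  shows "pres_class X R u = pres_class X R v \<longleftrightarrow> pres_eq X R u v"
  using assms unfolding pres_class_def
  by (auto intro: pres_eq.intros)

lemma presented_group_simps:
  "carrier (presented_group X R) = pres_class X R ` gwords X"
  "\<one>\<^bsub>presented_group X R\<^esub> = pres_class X R []"
  by (simp_all add: presented_group_def)

lemma presented_group_mult:
  assumes "u \<in> gwords X" "v \<in> gwords X"
  shows "pres_class X R u \<otimes>\<^bsub>presented_group X R\<^esub> pres_class X R v = pres_class X R (u @ v)"
  using assms unfolding presented_group_def pres_class_def
  by (auto intro: pres_eq.refl pres_eq.trans pres_eq_append)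

lemma pres_eq_inverse:
  assumes "w \<in> gwords X"
  shows "\<exists>v\<in>gwords X. pres_eq X R (v @ w) []"
  using assms
proof (induction w)
  case Nil
  then show ?case by (intro bexI[of _ "[]"]) (auto intro: pres_eq.refl)
next
  case (Cons p w)
  obtain g b where p: "p = (g, b)" by force
  with Cons obtain v where v: "v \<in> gwords X" "pres_eq X R (v @ w) []" and g: "g \<in> X"
    and w: "w \<in> gwords X" by auto
  have "pres_eq X R (v @ [(g, \<not> b), (g, \<not> \<not> b)] @ w) (v @ w)"
    using g v w by (intro pres_eq.cancel) auto
  then show ?case
    using v g p by (intro bexI[of _ "v @ [(g, \<not> b)]"]) (auto intro: pres_eq.trans)
qed

lemma presented_group_is_group: "group (presented_group X R)"
proof (rule groupI)
  fix P assume "P \<in> carrier (presented_group X R)"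
  then obtain w where w: "w \<in> gwords X" "P = pres_class X R w"
    by (auto simp: presented_group_simps)
  then obtain v where "v \<in> gwords X" "pres_eq X R (v @ w) []"
    using pres_eq_inverse by blast
  then show "\<exists>Q\<in>carrier (presented_group X R). Q \<otimes>\<^bsub>presented_group X R\<^esub> P = \<one>\<^bsub>presented_group X R\<^esub>"
    using w by (auto simp: presented_group_simps presented_group_mult pres_class_eq_iff)
qed (auto simp: presented_group_simps presented_group_mult)

text \<open>Evaluation of words in a group in which the relations hold.\<close>

primrec gword_eval :: "('h, 'm) monoid_scheme \<Rightarrow> ('g \<Rightarrow> 'h) \<Rightarrow> 'g gword \<Rightarrow> 'h" where
  "gword_eval H f [] = \<one>\<^bsub>H\<^esub>"
| "gword_eval H f (p # w) = (if snd p then f (fst p) else inv\<^bsub>H\<^esub> f (fst p)) \<otimes>\<^bsub>H\<^esub> gword_eval H f w"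

lemma gword_eval_closed:
  assumes "group H" "f \<in> X \<rightarrow> carrier H" "w \<in> gwords X"
  shows "gword_eval H f w \<in> carrier H"
proof -
  interpret group H by fact
  show ?thesis using assms(3)
  proof (induction w)
    case (Cons p w)
    then show ?case using assms(2) by (cases p) (auto intro!: m_closed inv_closed)
  qed simp
qed

lemma gword_eval_append:
  assumes "group H" "f \<in> X \<rightarrow> carrier H" "u \<in> gwords X" "v \<in> gwords X"
  shows "gword_eval H f (u @ v) = gword_eval H f u \<otimes>\<^bsub>H\<^esub> gword_eval H f v"
proof -
  interpret group H by fact
  show ?thesis using assms(3)
  proof (induction u)
    case (Cons p u)
    have "f (fst p) \<in> carrier H" using Cons.prems assms(2) by (cases p) auto
    then show ?case
      using Cons gword_eval_closed[OF assms(1,2)] assms(4) by (cases p) (auto simp: m_assoc)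
  qed (use gword_eval_closed[OF assms(1,2,4)] in simp)
qed

lemma gword_eval_pres_eq:
  assumes "group H" "f \<in> X \<rightarrow> carrier H"
    and rels: "\<And>l r. (l, r) \<in> R \<Longrightarrow> gword_eval H f l = gword_eval H f r"
    and "pres_eq X R u v"
  shows "gword_eval H f u = gword_eval H f v"
proof -
  interpret group H by fact
  show ?thesis using assms(4)
  proof (induction rule: pres_eq.induct)
    case (cancel g u v b)
    have "f g \<in> carrier H" using cancel assms(2) by auto
    then show ?case
      using cancel gword_eval_closed[OF assms(1,2)]
      by (cases b) (simp_all add: gword_eval_append[OF assms(1,2)] m_assoc[symmetric])
  next
    case (relation l r u v)
    then show ?case using rels by (simp add: gword_eval_append[OF assms(1,2)])
  qed auto
qed


subsection \<open>Generalized dicyclic groups\<close>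

datatype 'a dic_gen = DicA 'a | DicX

definition dic_gens :: "('a, 'm) monoid_scheme \<Rightarrow> 'a dic_gen set" where
  "dic_gens A = insert DicX (DicA ` carrier A)"

text \<open>The first family is the multiplication table of \<open>A\<close>, which the notation
  \<open>\<langle>A, x | \<dots>\<rangle>\<close> leaves implicit.\<close>

definition dic_rels ::
    "('a, 'm) monoid_scheme \<Rightarrow> 'a \<Rightarrow> ('a dic_gen gword \<times> 'a dic_gen gword) set" where
  "dic_rels A y =
     {([(DicA a, True), (DicA b, True)], [(DicA (a \<otimes>\<^bsub>A\<^esub> b), True)]) | a b.
        a \<in> carrier A \<and> b \<in> carrier A} \<union>
     {([(DicX, True), (DicX, True)], [(DicA y, True)])} \<union>
     {([(DicX, True), (DicA a, True), (DicX, False)], [(DicA (inv\<^bsub>A\<^esub> a), True)]) | a.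
        a \<in> carrier A}"

definition Dic :: "('a, 'm) monoid_scheme \<Rightarrow> 'a \<Rightarrow> 'a dic_gen gword set monoid" where
  "Dic A y = presented_group (dic_gens A) (dic_rels A y)"

definition dic_emb :: "('a, 'm) monoid_scheme \<Rightarrow> 'a \<Rightarrow> 'a \<Rightarrow> 'a dic_gen gword set" where
  "dic_emb A y a = pres_class (dic_gens A) (dic_rels A y) [(DicA a, True)]"

definition dic_x :: "('a, 'm) monoid_scheme \<Rightarrow> 'a \<Rightarrow> 'a dic_gen gword set" where
  "dic_x A y = pres_class (dic_gens A) (dic_rels A y) [(DicX, True)]"

definition group_exponent :: "('a, 'm) monoid_scheme \<Rightarrow> nat" where
  "group_exponent A = (LEAST n. 0 < n \<and> (\<forall>a\<in>carrier A. a [^]\<^bsub>A\<^esub> n = \<one>\<^bsub>A\<^esub>))"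

definition Cay :: "('g, 'm) monoid_scheme \<Rightarrow> 'g set \<Rightarrow> 'g sgraph" where
  "Cay G S = \<lparr>vertices = carrier G,
     edges = {{g, h} | g h. g \<in> carrier G \<and> h \<in> carrier G \<and> inv\<^bsub>G\<^esub> g \<otimes>\<^bsub>G\<^esub> h \<in> S}\<rparr>"

lemma Dic_is_group: "group (Dic A y)"
  unfolding Dic_def by (rule presented_group_is_group)

lemma dic_emb_closed: "a \<in> carrier A \<Longrightarrow> dic_emb A y a \<in> carrier (Dic A y)"
  by (auto simp: Dic_def dic_emb_def presented_group_simps dic_gens_def)

lemma dic_x_closed: "dic_x A y \<in> carrier (Dic A y)"
  by (auto simp: Dic_def dic_x_def presented_group_simps dic_gens_def)

lemma dic_rel_eq:
  assumes "(l, r) \<in> dic_rels A y" "l \<in> gwords (dic_gens A)" "r \<in> gwords (dic_gens A)"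
  shows "pres_class (dic_gens A) (dic_rels A y) l = pres_class (dic_gens A) (dic_rels A y) r"
  using pres_eq.relation[OF assms, of "[]" "[]"] assms(2) by (simp add: pres_class_eq_iff)

lemma dic_emb_hom:
  assumes "group A"
  shows "dic_emb A y \<in> hom A (Dic A y)"
proof (rule homI)
  interpret group A by fact
  fix a b assume ab: "a \<in> carrier A" "b \<in> carrier A"
  then show "dic_emb A y (a \<otimes>\<^bsub>A\<^esub> b) = dic_emb A y a \<otimes>\<^bsub>Dic A y\<^esub> dic_emb A y b"
    using dic_rel_eq[of "[(DicA a, True), (DicA b, True)]" "[(DicA (a \<otimes>\<^bsub>A\<^esub> b), True)]" A y]
    by (auto simp: Dic_def dic_emb_def presented_group_mult dic_gens_def dic_rels_def)
qed (rule dic_emb_closed)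

lemma dic_x_square:
  assumes "y \<in> carrier A"
  shows "dic_x A y \<otimes>\<^bsub>Dic A y\<^esub> dic_x A y = dic_emb A y y"
  using dic_rel_eq[of "[(DicX, True), (DicX, True)]" "[(DicA y, True)]" A y] assms
  by (auto simp: Dic_def dic_emb_def dic_x_def presented_group_mult dic_gens_def dic_rels_def)

lemma dic_x_inv:
  "inv\<^bsub>Dic A y\<^esub> dic_x A y = pres_class (dic_gens A) (dic_rels A y) [(DicX, False)]"
proof -
  interpret group "Dic A y" by (rule Dic_is_group)
  let ?z = "pres_class (dic_gens A) (dic_rels A y) [(DicX, False)]"
  have "?z \<in> carrier (Dic A y)"
    by (auto simp: Dic_def presented_group_simps dic_gens_def)
  moreover have "?z \<otimes>\<^bsub>Dic A y\<^esub> dic_x A y = \<one>\<^bsub>Dic A y\<^esub>"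
    using pres_eq.cancel[of DicX "dic_gens A" "[]" "[]" "dic_rels A y" False]
    by (simp add: Dic_def dic_x_def presented_group_mult presented_group_simps dic_gens_def
        pres_class_eq_iff)
  ultimately show ?thesis by (intro inv_equality dic_x_closed)
qed

lemma dic_x_conj:
  assumes "group A" "a \<in> carrier A"
  shows "dic_x A y \<otimes>\<^bsub>Dic A y\<^esub> dic_emb A y a \<otimes>\<^bsub>Dic A y\<^esub> inv\<^bsub>Dic A y\<^esub> dic_x A y
    = dic_emb A y (inv\<^bsub>A\<^esub> a)"
proof -
  interpret group A by fact
  have mem: "(DicX :: 'a dic_gen) \<in> dic_gens A" "DicA a \<in> dic_gens A"
    "DicA (inv\<^bsub>A\<^esub> a) \<in> dic_gens A"
    using assms(2) by (auto simp: dic_gens_def)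
  have "([(DicX, True), (DicA a, True), (DicX, False)], [(DicA (inv\<^bsub>A\<^esub> a), True)]) \<in> dic_rels A y"
    using assms(2) by (auto simp: dic_rels_def)
  from dic_rel_eq[OF this] mem show ?thesis
    unfolding dic_x_inv unfolding Dic_def dic_emb_def dic_x_def
    by (simp add: presented_group_mult)
qed

text \<open>The normal form: \<open>(a, e)\<close> represents \<open>x\<^sup>e a\<close>.\<close>

definition dic_model :: "('a, 'm) monoid_scheme \<Rightarrow> 'a \<Rightarrow> ('a \<times> bool) monoid" where
  "dic_model A y =
     \<lparr>carrier = carrier A \<times> UNIV,
      monoid.mult = (\<lambda>(a, e) (b, f).
        ((if e \<and> f then y else \<one>\<^bsub>A\<^esub>) \<otimes>\<^bsub>A\<^esub> ((if f then inv\<^bsub>A\<^esub> a else a) \<otimes>\<^bsub>A\<^esub> b), e \<noteq> f)),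
      one = (\<one>\<^bsub>A\<^esub>, False)\<rparr>"

definition dic_eval :: "('a, 'm) monoid_scheme \<Rightarrow> 'a dic_gen \<Rightarrow> 'a \<times> bool" where
  "dic_eval A g = (case g of DicA a \<Rightarrow> (a, False) | DicX \<Rightarrow> (\<one>\<^bsub>A\<^esub>, True))"

context
  fixes A :: "('a, 'm) monoid_scheme" (structure) and y :: 'a
  assumes A: "comm_group A" and y: "y \<in> carrier A" "y \<otimes> y = \<one>"
begin

interpretation comm_group A by (rule A)

lemma dic_model_is_group: "group (dic_model A y)"
proof (rule groupI)
  have yinv: "inv y = y" using y by (simp add: inv_equality)
  show "p \<otimes>\<^bsub>dic_model A y\<^esub> q \<otimes>\<^bsub>dic_model A y\<^esub> r = p \<otimes>\<^bsub>dic_model A y\<^esub> (q \<otimes>\<^bsub>dic_model A y\<^esub> r)"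
    if "p \<in> carrier (dic_model A y)" "q \<in> carrier (dic_model A y)" "r \<in> carrier (dic_model A y)"
    for p q r
    using that y yinv
    by (auto simp: dic_model_def inv_mult m_ac split: prod.splits if_splits)
  show "\<exists>q\<in>carrier (dic_model A y). q \<otimes>\<^bsub>dic_model A y\<^esub> p = \<one>\<^bsub>dic_model A y\<^esub>"
    if "p \<in> carrier (dic_model A y)" for p
  proof -
    obtain a e where "p = (a, e)" by (cases p)
    with that have p: "p = (a, e)" "a \<in> carrier A" by (simp_all add: dic_model_def)
    show ?thesis
      using y yinv p
      by (intro bexI[of _ "(if e then y \<otimes> a else inv a, e)"])
         (auto simp: dic_model_def inv_mult m_assoc[symmetric])
  qed
qed (use y in \<open>auto simp: dic_model_def\<close>)

lemma dic_eval_closed: "dic_eval A \<in> dic_gens A \<rightarrow> carrier (dic_model A y)"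
  by (auto simp: dic_eval_def dic_gens_def dic_model_def)

lemma dic_model_inv_x: "inv\<^bsub>dic_model A y\<^esub> (\<one>, True) = (y, True)"
  by (rule group.inv_equality[OF dic_model_is_group]) (use y in \<open>auto simp: dic_model_def\<close>)

lemma dic_eval_rels:
  assumes "(l, r) \<in> dic_rels A y"
  shows "gword_eval (dic_model A y) (dic_eval A) l = gword_eval (dic_model A y) (dic_eval A) r"
proof -
  have yy: "y \<otimes> (y \<otimes> b) = b" if "b \<in> carrier A" for b
    using that y by (simp add: m_assoc[symmetric])
  show ?thesis
    using assms y
    by (auto simp: dic_rels_def dic_eval_def dic_model_inv_x)
       (auto simp: dic_model_def m_ac yy)
qed

lemma pres_class_eval:
  assumes "pres_class (dic_gens A) (dic_rels A y) u = pres_class (dic_gens A) (dic_rels A y) v"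
    and "u \<in> gwords (dic_gens A)"
  shows "gword_eval (dic_model A y) (dic_eval A) u = gword_eval (dic_model A y) (dic_eval A) v"
  using assms gword_eval_pres_eq[OF dic_model_is_group dic_eval_closed dic_eval_rels]
  by (simp add: pres_class_eq_iff)

lemma dic_emb_inj: "inj_on (dic_emb A y) (carrier A)"
proof (rule inj_onI)
  fix a b assume "a \<in> carrier A" "b \<in> carrier A" "dic_emb A y a = dic_emb A y b"
  then show "a = b"
    using pres_class_eval[of "[(DicA a, True)]" "[(DicA b, True)]"]
    by (simp add: dic_emb_def dic_gens_def dic_eval_def dic_model_def)
qed

lemma dic_x_notin: "dic_x A y \<notin> dic_emb A y ` carrier A"
proof
  assume "dic_x A y \<in> dic_emb A y ` carrier A"
  then obtain a where "a \<in> carrier A" "dic_x A y = dic_emb A y a" by auto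
  then show False
    using pres_class_eval[of "[(DicX, True)]" "[(DicA a, True)]"]
    by (simp add: dic_emb_def dic_x_def dic_gens_def dic_eval_def dic_model_def)
qed

lemma Dic_carrier:
  "carrier (Dic A y) =
     dic_emb A y ` carrier A \<union> (dic_x A y <#\<^bsub>Dic A y\<^esub> (dic_emb A y ` carrier A))"
proof -
  let ?D = "Dic A y" and ?x = "dic_x A y" and ?i = "dic_emb A y"
  let ?c = "pres_class (dic_gens A) (dic_rels A y)"
  let ?N = "?i ` carrier A \<union> (?x <#\<^bsub>?D\<^esub> (?i ` carrier A))"
  interpret D: group ?D by (rule Dic_is_group)
  interpret i: group_hom A ?D ?i
    by unfold_locales (rule dic_emb_hom[OF is_group])
  have x: "?x \<in> carrier ?D" by (rule dic_x_closed)
  have xx: "?x \<otimes>\<^bsub>?D\<^esub> ?x = ?i y" using y(1) by (rule dic_x_square)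
  have N: "p \<in> ?N \<longleftrightarrow> (\<exists>a\<in>carrier A. p = ?i a \<or> p = ?x \<otimes>\<^bsub>?D\<^esub> ?i a)" for p
    by (auto simp: l_coset_def)
  have swap: "?i a \<otimes>\<^bsub>?D\<^esub> ?x = ?x \<otimes>\<^bsub>?D\<^esub> ?i (inv a)" if a: "a \<in> carrier A" for a
  proof -
    have "?x \<otimes>\<^bsub>?D\<^esub> ?i (inv a) \<otimes>\<^bsub>?D\<^esub> inv\<^bsub>?D\<^esub> ?x = ?i a"
      using dic_x_conj[OF is_group, of "inv a" y] a by simp
    then have "?i a \<otimes>\<^bsub>?D\<^esub> ?x = ?x \<otimes>\<^bsub>?D\<^esub> ?i (inv a) \<otimes>\<^bsub>?D\<^esub> inv\<^bsub>?D\<^esub> ?x \<otimes>\<^bsub>?D\<^esub> ?x"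
      by simp
    also have "\<dots> = ?x \<otimes>\<^bsub>?D\<^esub> ?i (inv a)"
      using a x by (simp add: D.m_assoc del: i.hom_inv)
    finally show ?thesis .
  qed
  have left_i: "?i a \<otimes>\<^bsub>?D\<^esub> p \<in> ?N" if a: "a \<in> carrier A" and p: "p \<in> ?N" for a p
  proof -
    obtain b where b: "b \<in> carrier A" "p = ?i b \<or> p = ?x \<otimes>\<^bsub>?D\<^esub> ?i b" using p N by blast
    have "?i a \<otimes>\<^bsub>?D\<^esub> ?i b = ?i (a \<otimes> b)" using a b by simp
    moreover have "?i a \<otimes>\<^bsub>?D\<^esub> (?x \<otimes>\<^bsub>?D\<^esub> ?i b) = ?x \<otimes>\<^bsub>?D\<^esub> ?i (inv a \<otimes> b)"
      using a b x swap[OF a] by (simp add: D.m_assoc[symmetric] del: i.hom_inv)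
    ultimately show ?thesis using a b unfolding N by (metis inv_closed m_closed)
  qed
  have left_x: "?x \<otimes>\<^bsub>?D\<^esub> p \<in> ?N" if p: "p \<in> ?N" for p
  proof -
    obtain b where b: "b \<in> carrier A" "p = ?i b \<or> p = ?x \<otimes>\<^bsub>?D\<^esub> ?i b" using p N by blast
    have "?x \<otimes>\<^bsub>?D\<^esub> (?x \<otimes>\<^bsub>?D\<^esub> ?i b) = ?i (y \<otimes> b)"
      using b x y xx by (simp add: D.m_assoc[symmetric])
    then show ?thesis using b y unfolding N by (metis m_closed)
  qed
  have "?i y \<otimes>\<^bsub>?D\<^esub> ?x \<otimes>\<^bsub>?D\<^esub> ?x = \<one>\<^bsub>?D\<^esub>"
  proof -
    have "?i y \<otimes>\<^bsub>?D\<^esub> ?x \<otimes>\<^bsub>?D\<^esub> ?x = ?i y \<otimes>\<^bsub>?D\<^esub> ?i y"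
      using x y xx by (simp add: D.m_assoc)
    also have "\<dots> = ?i (y \<otimes> y)" using y(1) by simp
    also have "\<dots> = \<one>\<^bsub>?D\<^esub>" unfolding y(2) by (rule i.hom_one)
    finally show ?thesis .
  qed
  then have xinv: "inv\<^bsub>?D\<^esub> ?x = ?i y \<otimes>\<^bsub>?D\<^esub> ?x"
    using D.inv_equality x y by simp
  have "?c w \<in> ?N" if "w \<in> gwords (dic_gens A)" for w
    using that
  proof (induction w)
    case Nil
    have "?c [] = ?i \<one>" using i.hom_one by (simp add: Dic_def presented_group_simps)
    then show ?case by blast
  next
    case (Cons p w)
    obtain g b where p: "p = (g, b)" by force
    then have gw: "g \<in> dic_gens A" "w \<in> gwords (dic_gens A)" using Cons.prems by auto
    then have cw: "?c w \<in> ?N" "?c w \<in> carrier ?D"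
      using Cons.IH by (auto simp: Dic_def presented_group_simps)
    have split: "?c (p # w) = ?c [(g, b)] \<otimes>\<^bsub>?D\<^esub> ?c w"
      using gw p by (simp add: Dic_def presented_group_mult)
    show ?case
    proof (cases g)
      case DicX
      show ?thesis
      proof (cases b)
        case True
        then show ?thesis using split DicX left_x[OF cw(1)] by (simp add: dic_x_def)
      next
        case False
        then have "?c (p # w) = ?i y \<otimes>\<^bsub>?D\<^esub> (?x \<otimes>\<^bsub>?D\<^esub> ?c w)"
          using split DicX xinv x y cw(2) dic_emb_closed[OF y(1)]
          by (simp add: dic_x_inv[symmetric] D.m_assoc)
        then show ?thesis using left_i[OF y(1) left_x[OF cw(1)]] by simp
      qed
    next
      case (DicA a)
      then have a: "a \<in> carrier A" using gw by (auto simp: dic_gens_def)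
      show ?thesis
      proof (cases b)
        case True
        then show ?thesis using split DicA left_i[OF a cw(1)] by (simp add: dic_emb_def)
      next
        case False
        have "?c [(DicA a, False)] \<otimes>\<^bsub>?D\<^esub> ?i a = \<one>\<^bsub>?D\<^esub>"
          using pres_eq.cancel[of "DicA a" "dic_gens A" "[]" "[]" "dic_rels A y" False] a
          by (simp add: Dic_def dic_emb_def presented_group_mult presented_group_simps
              dic_gens_def pres_class_eq_iff)
        moreover have "?c [(DicA a, False)] \<in> carrier ?D"
          using a by (auto simp: Dic_def presented_group_simps dic_gens_def)
        ultimately have "?c [(DicA a, False)] = ?i (inv a)"
          using a D.inv_equality[of "?c [(DicA a, False)]" "?i a"] by simp
        then show ?thesis using split DicA False left_i[OF inv_closed[OF a] cw(1)] by simp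
      qed
    qed
  qed
  then have "carrier ?D \<subseteq> ?N" by (auto simp: Dic_def presented_group_simps)
  moreover have "?N \<subseteq> carrier ?D" using x by (auto simp: l_coset_def)
  ultimately show ?thesis by (rule equalityI)
qed

end

end

theory Submission
  imports Defs
begin

text \<open>Write \<open>F = f\<^sub>1 + x f\<^sub>2\<close> for the indicator function of \<open>S\<close> or for the word length
  with respect to \<open>S\<close>. Both \<open>f\<^sub>1\<close> and \<open>f\<^sub>2\<close> are even functions on \<open>A\<close>, and \<open>f\<^sub>2\<close> is
  invariant under translation by \<open>y\<close>, so the eigenvalues of convolution by \<open>F\<close> are those of
  convolution by \<open>f\<^sub>1 + f\<^sub>2\<close> and \<open>f\<^sub>1 - f\<^sub>2\<close> on the abelian group \<open>A\<close>.

  For an integer-valued \<open>u\<close> on \<open>A\<close> these eigenvalues are the character sums of \<open>u\<close>. They are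
  all integers if and only if \<open>u (a\<^sup>p) = u a\<close> for all large primes \<open>p\<close>. If they are integers,
  then \<open>u\<^sup>p \<equiv> u\<close> modulo \<open>p\<close> in the integral group ring, by interpolation at the eigenvalues,
  while the Frobenius map gives \<open>u\<^sup>p \<equiv> \<Sum> u(a) a\<^sup>p\<close>; a congruence modulo a large \<open>p\<close> between bounded
  integers is an equality. Conversely, every unit residue class modulo the order of \<open>a\<close> contains
  a product of large primes, so \<open>u\<close> is constant on the generators of each cyclic subgroup and its
  character sums are integer combinations of Ramanujan sums.

  For \<open>p\<close> prime to \<open>|A|\<close>, the map fixing \<open>x\<close> and raising \<open>A\<close> to the power \<open>p\<close> is an automorphism of
  \<open>Dic(A, y)\<close>. If it preserves \<open>S\<close> it preserves word length, and conversely \<open>S\<close> consists of the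
  elements of length \<open>1\<close>.\<close>


section \<open>Integer arithmetic\<close>

text \<open>The interior binomial coefficients are divisible by \<open>p\<close>. The quotients
  \<open>c k\<close> are chosen before \<open>x\<close> and \<open>y\<close>, so the error term is a
  fixed integer polynomial; it is used over the integers and over the complex numbers.\<close>

lemma prime_binomial_expansion:
  assumes "prime p"
  shows "\<exists>c :: nat \<Rightarrow> nat. \<forall>x y :: 'a :: comm_ring_1.
    (x + y) ^ p = x ^ p + y ^ p + of_nat p * (\<Sum>k\<in>{1..<p}. of_nat (c k) * x ^ k * y ^ (p - k))"
proof -
  have p: "p > 0" using assms by (simp add: prime_gt_0_nat)
  define c where "c = (\<lambda>k. (p choose k) div p)"
  have c: "p choose k = p * c k" if "k \<in> {1..<p}" for k
    using that assms dvd_choose_prime[of k p] by (auto simp: c_def)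
  have "(x + y) ^ p = x ^ p + y ^ p + of_nat p * (\<Sum>k\<in>{1..<p}. of_nat (c k) * x ^ k * y ^ (p - k))"
    for x y :: 'a
  proof -
    have "{..p} = insert 0 (insert p {1..<p})" using p by auto
    then have "(x + y) ^ p
        = y ^ p + (x ^ p + (\<Sum>k\<in>{1..<p}. of_nat (p choose k) * x ^ k * y ^ (p - k)))"
      using p by (simp add: binomial_ring)
    also have "(\<Sum>k\<in>{1..<p}. of_nat (p choose k) * x ^ k * y ^ (p - k))
        = of_nat p * (\<Sum>k\<in>{1..<p}. of_nat (c k) * x ^ k * y ^ (p - k))"
      unfolding sum_distrib_left
      by (intro sum.cong HOL.refl) (use c in \<open>simp add: mult.assoc\<close>)
    finally show ?thesis by (simp add: add_ac)
  qed
  then show ?thesis by blast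
qed

text \<open>Fermat's congruence by induction away from 0 in both directions; each step is the
  binomial expansion with \<open>y = 1\<close>.\<close>

lemma prime_dvd_power_minus_self_int:
  fixes l :: int
  assumes "prime p"
  shows "int p dvd l ^ p - l"
proof -
  have p: "p > 0" using assms by (simp add: prime_gt_0_nat)
  obtain c where c: "\<And>x y :: int. (x + y) ^ p
      = x ^ p + y ^ p + of_nat p * (\<Sum>k\<in>{1..<p}. of_nat (c k) * x ^ k * y ^ (p - k))"
    using prime_binomial_expansion[OF assms] by blast
  have step: "int p dvd (l + 1) ^ p - l ^ p - 1" for l
    using c[of l 1] by simp
  show ?thesis
  proof (induction l rule: int_induct[where k = 0])
    case base
    then show ?case using p by (simp add: zero_power)
  next
    case (step1 l)
    then show ?case using dvd_add[OF step[of l] step1(2)] by (simp add: algebra_simps)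
  next
    case (step2 l)
    then show ?case using dvd_diff[OF step2(2) step[of "l - 1"]] by (simp add: algebra_simps)
  qed
qed

text \<open>Newton interpolation modulo \<open>p\<close>.\<close>

lemma poly_multiple_on_incongruent_set:
  fixes h :: "int poly"
  assumes "prime (p :: int)" "finite L" "\<And>l. l \<in> L \<Longrightarrow> p dvd poly h l"
    and "\<And>l l'. l \<in> L \<Longrightarrow> l' \<in> L \<Longrightarrow> l \<noteq> l' \<Longrightarrow> \<not> p dvd l - l'"
  shows "\<exists>r. \<forall>l\<in>L. poly h l = p * poly r l"
  using assms(2-4)
proof (induction L arbitrary: h)
  case (insert m L)
  obtain c where c: "poly h m = p * c" using insert.prems(1)[of m] by (auto elim: dvdE)
  \<comment> \<open>Division by \<open>X - m\<close> leaves the remainder \<open>p * c\<close>. The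
    quotient \<open>g\<close> is again a multiple of \<open>p\<close> at the remaining points,
    because \<open>l - m\<close> is prime to \<open>p\<close> there.\<close>
  define g where "g = synthetic_div h m"
  have h: "poly h l = (l - m) * poly g l + p * c" for l
  proof -
    have "h + smult m g = pCons (poly h m) g"
      unfolding g_def by (rule synthetic_div_correct)
    then have "poly (h + smult m g) l = poly (pCons (p * c) g) l" by (simp add: c)
    then show ?thesis by (simp add: algebra_simps)
  qed
  have "p dvd poly g l" if l: "l \<in> L" for l
  proof -
    have "p dvd (l - m) * poly g l"
      using insert.prems(1)[of l] l by (simp add: h dvd_add_left_iff)
    moreover have "\<not> p dvd l - m" using insert.prems(2)[of l m] insert.hyps l by auto
    ultimately show ?thesis using assms(1) prime_dvd_mult_iff by blast
  qed
  then obtain r where "\<forall>l\<in>L. poly g l = p * poly r l"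
    using insert.IH[of g] insert.prems(2) by auto
  then have "\<forall>l\<in>insert m L. poly h l = p * poly ([:- m, 1:] * r + [:c:]) l"
    by (auto simp: h algebra_simps)
  then show ?case by blast
qed auto

text \<open>An elementary stand-in for Dirichlet's theorem. With \<open>j\<close> the product of the
  primes up to \<open>M\<close> that do not divide \<open>k\<close>, every prime up to
  \<open>M\<close> divides exactly one of \<open>k\<close> and \<open>m * j\<close>, hence not their
  sum.\<close>

lemma exists_coprime_in_progression:
  fixes k m M :: nat
  assumes "coprime k m"
  obtains j where "k + m * j > 0" "\<And>p. prime p \<Longrightarrow> p dvd k + m * j \<Longrightarrow> p > M"
proof -
  define Q where "Q = {p. prime p \<and> p \<le> M \<and> \<not> p dvd k}"
  define j where "j = \<Prod>Q"
  have finQ: "finite Q" by (rule finite_subset[of _ "{..M}"]) (auto simp: Q_def)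
  have "j > 0" unfolding j_def by (rule prod_pos) (auto simp: Q_def prime_gt_0_nat)
  have "k > 0 \<or> m > 0" using assms by (cases "k = 0"; cases "m = 0") auto
  then have "k + m * j > 0" using \<open>j > 0\<close> by auto
  moreover have "p > M" if p: "prime p" "p dvd k + m * j" for p
  proof (rule ccontr)
    assume "\<not> p > M"
    show False
    proof (cases "p dvd k")
      case True
      then have "p dvd m * j" using p(2) dvd_add_right_iff by blast
      moreover have "\<not> p dvd m" using True assms p(1) by (metis coprime_common_divisor not_prime_unit)
      ultimately have "p dvd j" using p(1) prime_dvd_mult_iff by blast
      then obtain q where "q \<in> Q" "p dvd q"
        using p(1) finQ unfolding j_def by (metis prime_dvd_prod_iff)
      then have "p = q" using p(1) by (auto simp: Q_def primes_dvd_imp_eq)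
      then show False using True \<open>q \<in> Q\<close> by (simp add: Q_def)
    next
      case False
      then have "p \<in> Q" using p(1) \<open>\<not> p > M\<close> by (simp add: Q_def)
      then have "p dvd j" using finQ dvd_prodI[of Q p "\<lambda>q. q"] by (simp add: j_def)
      then show False using False p(2) by (simp add: dvd_add_left_iff)
    qed
  qed
  ultimately show ?thesis by (rule that)
qed

text \<open>The sum of \<open>z ^ k\<close> over all \<open>k\<close> in \<open>{1..m}\<close> is 0
  or \<open>m\<close>. Grouped by \<open>d = gcd k m\<close>, it becomes a sum of expressions of the
  same kind for the modulus \<open>m div d\<close> and the root \<open>z ^ d\<close>; the term
  \<open>d = 1\<close> is the one wanted, and the others are integers by induction. The root
  \<open>z\<close> need not be primitive.\<close>

lemma ramanujan_sum_Ints: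
  fixes z :: complex
  assumes "m > 0" "z ^ m = 1"
  shows "(\<Sum>k | k \<in> {1..m} \<and> coprime k m. z ^ k) \<in> \<int>"
  using assms
proof (induction m arbitrary: z rule: less_induct)
  case (less m)
  define R where "R = (\<lambda>m z. \<Sum>k | k \<in> {1..m} \<and> coprime k m. z ^ k :: complex)"
  have geo: "(\<Sum>k\<in>{1..m}. z ^ k) \<in> \<int>"
  proof (cases "z = 1")
    case False
    have "(\<Sum>k\<in>{1..m}. z ^ k) = (\<Sum>k<m. z ^ Suc k)"
      by (rule sum.reindex_bij_witness[of _ Suc "\<lambda>k. k - 1"]) auto
    also have "\<dots> = z * (\<Sum>k<m. z ^ k)" by (simp add: sum_distrib_left)
    also have "\<dots> = 0" using False less.prems by (simp add: geometric_sum)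
    finally show ?thesis by simp
  qed simp
  have "(\<Sum>k\<in>{1..m}. z ^ k) = (\<Sum>d | d dvd m. \<Sum>k | k \<in> {1..m} \<and> gcd k m = d. z ^ k)"
    using less.prems by (subst sum.group[symmetric, where T = "{d. d dvd m}" and g = "\<lambda>k. gcd k m"]) auto
  also have "\<dots> = (\<Sum>d | d dvd m. R (m div d) (z ^ d))"
  proof (rule sum.cong[OF HOL.refl])
    fix d assume "d \<in> {d. d dvd m}"
    then obtain e where e: "m = d * e" by auto
    then have d: "d > 0" "e > 0" using less.prems by auto
    have "(\<Sum>k | k \<in> {1..m} \<and> gcd k m = d. z ^ k) = (\<Sum>k | k \<in> {1..e} \<and> coprime k e. z ^ (d * k))"
    proof (rule sum.reindex_bij_witness[of _ "\<lambda>k. d * k" "\<lambda>k. k div d"])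
      fix k assume k: "k \<in> {k. k \<in> {1..m} \<and> gcd k m = d}"
      then have "d dvd k" by auto
      then obtain q where q: "k = d * q" by auto
      show "d * (k div d) = k" using q d by simp
      show "k div d \<in> {k. k \<in> {1..e} \<and> coprime k e}"
        using k q d e by (auto simp: gcd_mult_distrib_nat[symmetric] coprime_iff_gcd_eq_1)
      show "z ^ (d * (k div d)) = z ^ k" using q d by simp
    next
      fix k assume "k \<in> {k. k \<in> {1..e} \<and> coprime k e}"
      then show "d * k \<in> {k. k \<in> {1..m} \<and> gcd k m = d}" "d * k div d = k"
        using d e by (auto simp: gcd_mult_distrib_nat[symmetric] coprime_iff_gcd_eq_1)
    qed
    then show "(\<Sum>k | k \<in> {1..m} \<and> gcd k m = d. z ^ k) = R (m div d) (z ^ d)"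
      using e d by (simp add: R_def power_mult)
  qed
  also have "\<dots> = R m z + (\<Sum>d\<in>{d. d dvd m} - {1}. R (m div d) (z ^ d))"
    using less.prems by (subst sum.remove[of _ 1]) auto
  finally have "R m z = (\<Sum>k\<in>{1..m}. z ^ k) - (\<Sum>d\<in>{d. d dvd m} - {1}. R (m div d) (z ^ d))"
    by simp
  moreover have "(\<Sum>d\<in>{d. d dvd m} - {1}. R (m div d) (z ^ d)) \<in> \<int>"
  proof (rule Ints_sum)
    fix d assume d: "d \<in> {d. d dvd m} - {1}"
    then have "d > 0" "m div d < m" "m div d > 0" "d * (m div d) = m"
      using less.prems by (auto simp: dvd_imp_le Suc_lessI intro!: Nat.gr0I div_less_dividend)
    then show "R (m div d) (z ^ d) \<in> \<int>"
      unfolding R_def using less.prems by (intro less.IH) (auto simp: power_mult[symmetric])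
  qed
  ultimately show ?case using geo by (simp add: R_def)
qed


section \<open>Integral character sums on finite abelian groups\<close>

text \<open>The orthogonality relation that inverts the discrete Fourier transform along the powers
  of a single element.\<close>

lemma geometric_sum_root_of_unity:
  fixes n j :: nat
  assumes "j < n"
  shows "(\<Sum>m<n. cis (2 * pi / n) ^ (m * j)) = (if j = 0 then of_nat n else 0)"
proof (cases "j = 0")
  case False
  define z where "z = cis (2 * pi / n) ^ j"
  have z: "z = cis (2 * pi * j / n)" by (simp add: z_def DeMoivre mult_ac)
  have "z \<noteq> 1"
  proof
    assume "z = 1"
    then have "cis (2 * pi * real j / real n) = cis (2 * pi * real 0 / real n)" using z by simp
    then have "j = 0"
      using bij_betw_roots_unity[of n] assms unfolding bij_betw_def inj_on_def by force
    with False show False by simp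
  qed
  moreover have "z ^ n = 1"
    using assms by (simp add: z DeMoivre)
  ultimately have "(\<Sum>m<n. z ^ m) = 0"
    by (simp add: geometric_sum)
  then show ?thesis using False
    by (simp add: z_def power_mult[symmetric] mult.commute)
qed simp

lemma sum_list_concat_map:
  "(\<Sum>k\<leftarrow>concat (map g xs). f k) = (\<Sum>x\<leftarrow>xs. \<Sum>k\<leftarrow>g x. f k)"
  by (induction xs) auto

text \<open>The operator is convolution by \<open>F\<close>. For the indicator function of a
  connection set its matrix is the adjacency matrix of the Cayley graph, and for word length it is
  the distance matrix.\<close>

definition (in group) conv_eigenvalue :: "('a \<Rightarrow> int) \<Rightarrow> complex \<Rightarrow> bool" where
  "conv_eigenvalue F l \<longleftrightarrow> (\<exists>h. (\<exists>g\<in>carrier G. h g \<noteq> 0) \<and>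
     (\<forall>u\<in>carrier G. (\<Sum>v\<in>carrier G. of_int (F (inv u \<otimes> v)) * h v) = l * h u))"

locale finite_comm_group = comm_group +
  assumes fin [simp]: "finite (carrier G)"
begin

section \<open>Characters and the Fourier expansion of the delta function\<close>

definition is_char :: "('a \<Rightarrow> complex) \<Rightarrow> bool" where
  "is_char \<chi> \<longleftrightarrow> \<chi> \<one> = 1 \<and> (\<forall>a\<in>carrier G. \<forall>b\<in>carrier G. \<chi> (a \<otimes> b) = \<chi> a * \<chi> b)"

lemma is_char_mult: "is_char \<chi> \<Longrightarrow> a \<in> carrier G \<Longrightarrow> b \<in> carrier G \<Longrightarrow> \<chi> (a \<otimes> b) = \<chi> a * \<chi> b"
  by (simp add: is_char_def)

lemma is_char_pow:
  assumes "is_char \<chi>" "a \<in> carrier G"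
  shows "\<chi> (a [^] (k::nat)) = \<chi> a ^ k"
  using assms by (induction k) (auto simp: is_char_def)

text \<open>Averaging over the powers of \<open>b\<close> against roots of unity is the projection onto the
  eigenspaces of translation by \<open>b\<close>.\<close>

lemma translation_eigenvector_split:
  fixes h :: "'a \<Rightarrow> complex"
  assumes "finite B" "B \<subseteq> carrier G"
  shows "\<exists>ks. (\<forall>k\<in>set ks. \<forall>b\<in>B. \<exists>z. \<forall>a\<in>carrier G. k (a \<otimes> b) = z * k a) \<and>
    (\<forall>a\<in>carrier G. h a = (\<Sum>k\<leftarrow>ks. k a))"
  using assms
proof (induction B)
  case empty
  show ?case by (rule exI[of _ "[h]"]) simp
next
  case (insert b B)
  then obtain ks where
    ks: "\<forall>k\<in>set ks. \<forall>c\<in>B. \<exists>z. \<forall>a\<in>carrier G. k (a \<otimes> c) = z * k a"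
    and h: "\<forall>a\<in>carrier G. h a = (\<Sum>k\<leftarrow>ks. k a)"
    by auto
  have b: "b \<in> carrier G" and B: "B \<subseteq> carrier G" using insert by auto
  define n where "n = Coset.order G"
  have n: "n > 0" by (simp add: n_def order_gt_0_iff_finite)
  define w where "w = cis (2 * pi / n)"
  have w: "w ^ n = 1" "w \<noteq> 0" using n by (auto simp: w_def DeMoivre)
  \<comment> \<open>\<open>P k m\<close> is the component of \<open>k\<close> on which translation
    by \<open>b\<close> acts as \<open>inverse (w ^ m)\<close>. Since \<open>n\<close> is the group
    order, \<open>b [^] n\<close> is the identity whatever the order of \<open>b\<close>; some
    components may vanish.\<close>
  define P where "P = (\<lambda>k m a. (\<Sum>j<n. w ^ (m * j) * k (a \<otimes> b [^] j)) / of_nat n)"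
  have P_b: "P k m (a \<otimes> b) = inverse (w ^ m) * P k m a"
    if a: "a \<in> carrier G" for k :: "'a \<Rightarrow> complex" and m a
  proof -
    define f where "f = (\<lambda>j. w ^ (m * j) * k (a \<otimes> b [^] j))"
    have "f n = f 0"
      using a b w by (simp add: f_def n_def pow_order_eq_1) (metis mult.commute power_mult power_one)
    have "w ^ m * (\<Sum>j<n. w ^ (m * j) * k (a \<otimes> b \<otimes> b [^] j)) = (\<Sum>j<n. f (Suc j))"
      using a b by (simp add: f_def sum_distrib_left power_add mult_ac m_assoc
          nat_pow_Suc2[symmetric] del: nat_pow_Suc)
    also have "\<dots> = (\<Sum>j<n. f j)"
      using sum.lessThan_Suc_shift[of f n] \<open>f n = f 0\<close> by simp
    finally have "w ^ m * P k m (a \<otimes> b) = P k m a" by (simp add: P_def f_def)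
    then show ?thesis using w by (simp add: field_simps)
  qed
  \<comment> \<open>Translations by \<open>b\<close> and \<open>c\<close> commute, so the projection
    keeps the eigenvalues already obtained for \<open>B\<close>.\<close>
  have P_B: "\<exists>z. \<forall>a\<in>carrier G. P k m (a \<otimes> c) = z * P k m a" if kc: "k \<in> set ks" "c \<in> B" for k m c
  proof -
    obtain z where z: "\<And>a. a \<in> carrier G \<Longrightarrow> k (a \<otimes> c) = z * k a" using ks kc by blast
    have c: "c \<in> carrier G" using B kc by auto
    have "P k m (a \<otimes> c) = z * P k m a" if a: "a \<in> carrier G" for a
    proof -
      have "k (a \<otimes> c \<otimes> b [^] j) = z * k (a \<otimes> b [^] j)" for j :: nat
        using z[of "a \<otimes> b [^] j"] a b c by (simp add: m_assoc m_comm[of c])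
      then show ?thesis by (simp add: P_def sum_distrib_left mult_ac)
    qed
    then show ?thesis by blast
  qed
  have P_sum: "(\<Sum>m<n. P k m a) = k a" if a: "a \<in> carrier G" for k a
  proof -
    have "(\<Sum>m<n. P k m a) = (\<Sum>j<n. k (a \<otimes> b [^] j) * (\<Sum>m<n. w ^ (m * j))) / of_nat n"
      unfolding P_def sum_divide_distrib[symmetric] sum_distrib_left
      by (subst sum.swap) (simp add: mult_ac)
    also have "\<dots> = (\<Sum>j<n. if j = 0 then k a * of_nat n else 0) / of_nat n"
      using a by (intro arg_cong2[where f = "(/)"] sum.cong)
        (auto simp: w_def geometric_sum_root_of_unity)
    also have "\<dots> = k a" using n by (simp add: sum.delta)
    finally show ?thesis .
  qed
  let ?ks = "concat (map (\<lambda>k. map (P k) [0..<n]) ks)"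
  have "\<exists>z. \<forall>a\<in>carrier G. k (a \<otimes> c) = z * k a" if "k \<in> set ?ks" "c \<in> insert b B" for k c
    using that P_B P_b by auto
  moreover have "h a = (\<Sum>k\<leftarrow>?ks. k a)" if "a \<in> carrier G" for a
    using that by (simp add: sum_list_concat_map h comp_def interv_sum_list_conv_sum_set_nat
        atLeast0LessThan P_sum)
  ultimately show ?case by blast
qed

text \<open>The delta function is split into joint eigenvectors of all translations. Such a
  \<open>k\<close> satisfies \<open>k (a \<otimes> b) * k \<one> = k a * k b\<close>, so it is
  \<open>k \<one>\<close> times a character or zero.\<close>

lemma delta_character_expansion:
  obtains N :: nat and c :: "nat \<Rightarrow> complex" and \<chi> where "\<And>i. is_char (\<chi> i)"
    "\<And>a. a \<in> carrier G \<Longrightarrow> (\<Sum>i<N. c i * \<chi> i a) = (if a = \<one> then 1 else 0)"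
proof -
  obtain ks where
    ks: "\<And>k b. k \<in> set ks \<Longrightarrow> b \<in> carrier G \<Longrightarrow> \<exists>z. \<forall>a\<in>carrier G. k (a \<otimes> b) = z * k a"
    and sum: "\<And>a. a \<in> carrier G \<Longrightarrow> (if a = \<one> then 1 else 0 :: complex) = (\<Sum>k\<leftarrow>ks. k a)"
    using translation_eigenvector_split[of "carrier G" "\<lambda>a. if a = \<one> then 1 else 0"]
    by auto metis
  have mult: "k (a \<otimes> b) * k \<one> = k a * k b"
    if "k \<in> set ks" and ab: "a \<in> carrier G" "b \<in> carrier G" for k a b
  proof -
    obtain z where z: "\<And>a. a \<in> carrier G \<Longrightarrow> k (a \<otimes> b) = z * k a" using ks[OF \<open>k \<in> set ks\<close> ab(2)] by blast
    show ?thesis using z[of a] z[of \<one>] ab by simp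
  qed
  define c where "c = (\<lambda>i. (ks ! i) \<one>)"
  \<comment> \<open>A component vanishing at the identity vanishes everywhere, since
    \<open>k a * k a\<close> equals \<open>k (a \<otimes> a) * k \<one>\<close>. The trivial
    character then stands in for it with coefficient 0; it also fills the indices beyond the
    list.\<close>
  define \<chi> where "\<chi> = (\<lambda>i a. if i < length ks \<and> c i \<noteq> 0 then (ks ! i) a / c i else 1)"
  have "is_char (\<chi> i)" for i
    using mult[of "ks ! i"] by (auto simp: is_char_def \<chi>_def c_def field_simps)
  moreover have "(\<Sum>i<length ks. c i * \<chi> i a) = (if a = \<one> then 1 else 0)" if a: "a \<in> carrier G" for a
  proof -
    have "c i * \<chi> i a = (ks ! i) a" if "i < length ks" for i
      using mult[of "ks ! i" a \<one>] mult[of "ks ! i" \<one> \<one>] mult[of "ks ! i" a "inv a"]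
        mult[of "ks ! i" a a] that a by (auto simp: \<chi>_def c_def)
    then show ?thesis
      using sum[OF a] by (simp add: sum_list_sum_nth atLeast0LessThan)
  qed
  ultimately show ?thesis by (rule that)
qed

section \<open>The spectrum of convolution as a set of character sums\<close>

definition char_sum :: "('a \<Rightarrow> int) \<Rightarrow> ('a \<Rightarrow> complex) \<Rightarrow> complex" where
  "char_sum u \<chi> = (\<Sum>a\<in>carrier G. of_int (u a) * \<chi> a)"

lemma sum_translate:
  assumes "g \<in> carrier G"
  shows "(\<Sum>a\<in>carrier G. f (g \<otimes> a)) = (\<Sum>a\<in>carrier G. f a)"
  by (rule sum.reindex_bij_witness[of _ "\<lambda>a. inv g \<otimes> a" "\<lambda>a. g \<otimes> a"])
     (use assms in \<open>auto simp: m_assoc[symmetric]\<close>)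

lemma sum_inv: "(\<Sum>a\<in>carrier G. f (inv a)) = (\<Sum>a\<in>carrier G. f a)"
  by (rule sum.reindex_bij_witness[of _ "\<lambda>a. inv a" "\<lambda>a. inv a"]) auto

lemma conv_eigenvalue_translates:
  "conv_eigenvalue u l \<longleftrightarrow> (\<exists>h. (\<exists>a\<in>carrier G. h a \<noteq> 0) \<and>
     (\<forall>g\<in>carrier G. (\<Sum>a\<in>carrier G. of_int (u a) * h (g \<otimes> a)) = l * h g))"
proof -
  have "(\<Sum>v\<in>carrier G. of_int (u (inv g \<otimes> v)) * h v) = (\<Sum>a\<in>carrier G. of_int (u a) * h (g \<otimes> a))"
    if g: "g \<in> carrier G" for g and h :: "'a \<Rightarrow> complex"
  proof -
    have "(\<Sum>a\<in>carrier G. of_int (u a) * h (g \<otimes> a))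
        = (\<Sum>a\<in>carrier G. of_int (u (inv g \<otimes> (g \<otimes> a))) * h (g \<otimes> a))"
      using g by (intro sum.cong) (auto simp: m_assoc[symmetric])
    also have "\<dots> = (\<Sum>v\<in>carrier G. of_int (u (inv g \<otimes> v)) * h v)"
      by (rule sum_translate[OF g])
    finally show ?thesis by simp
  qed
  then show ?thesis by (simp add: conv_eigenvalue_def)
qed

text \<open>A character is an eigenvector for its own character sum. Conversely, an eigenvector has
  a nonzero Fourier coefficient, and pairing the eigenvalue equation with that character determines
  \<open>l\<close>.\<close>

lemma conv_eigenvalue_iff_char_sum:
  "conv_eigenvalue u l \<longleftrightarrow> (\<exists>\<chi>. is_char \<chi> \<and> l = char_sum u \<chi>)"
proof
  assume "\<exists>\<chi>. is_char \<chi> \<and> l = char_sum u \<chi>"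
  then obtain \<chi> where \<chi>: "is_char \<chi>" "l = char_sum u \<chi>" by auto
  have "(\<Sum>a\<in>carrier G. of_int (u a) * \<chi> (g \<otimes> a)) = l * \<chi> g" if "g \<in> carrier G" for g
    using that \<chi> by (simp add: char_sum_def is_char_mult sum_distrib_left mult_ac)
  moreover have "\<chi> \<one> \<noteq> 0" using \<chi> by (simp add: is_char_def)
  ultimately show "conv_eigenvalue u l" unfolding conv_eigenvalue_translates by blast
next
  assume "conv_eigenvalue u l"
  then obtain h where nz: "\<exists>a\<in>carrier G. h a \<noteq> 0"
    and h: "\<And>g. g \<in> carrier G \<Longrightarrow> (\<Sum>a\<in>carrier G. of_int (u a) * h (g \<otimes> a)) = l * h g"
    unfolding conv_eigenvalue_translates by blast
  obtain g where g: "g \<in> carrier G" "h g \<noteq> 0" using nz by blast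
  obtain N :: nat and c \<chi> where \<chi>: "\<And>i. is_char (\<chi> i)"
    and delta: "\<And>a. a \<in> carrier G \<Longrightarrow> (\<Sum>i<N. c i * \<chi> i a) = (if a = \<one> then 1 else 0)"
    by (rule delta_character_expansion) blast
  \<comment> \<open>The Fourier coefficients of \<open>h\<close>, with \<open>inv a\<close> in place
    of complex conjugation.\<close>
  define H where "H = (\<lambda>i. \<Sum>a\<in>carrier G. h a * \<chi> i (inv a))"
  have "h g = (\<Sum>a\<in>carrier G. h a * (if g \<otimes> inv a = \<one> then 1 else 0))"
  proof -
    have "g \<otimes> inv a = \<one> \<longleftrightarrow> a = g" if "a \<in> carrier G" for a
      using g that by (metis inv_closed inv_equality inv_inv r_inv)
    then have "(\<Sum>a\<in>carrier G. h a * (if g \<otimes> inv a = \<one> then 1 else 0))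
        = (\<Sum>a\<in>carrier G. if a = g then h a else 0)"
      by (intro sum.cong) auto
    also have "\<dots> = h g" using g by simp
    finally show ?thesis by simp
  qed
  also have "\<dots> = (\<Sum>a\<in>carrier G. h a * (\<Sum>i<N. c i * \<chi> i (g \<otimes> inv a)))"
  proof (rule sum.cong[OF HOL.refl])
    fix a assume "a \<in> carrier G"
    then have "g \<otimes> inv a \<in> carrier G" using g by simp
    from delta[OF this] show "h a * (if g \<otimes> inv a = \<one> then 1 else 0)
        = h a * (\<Sum>i<N. c i * \<chi> i (g \<otimes> inv a))" by simp
  qed
  also have "\<dots> = (\<Sum>i<N. c i * \<chi> i g * H i)"
    unfolding H_def sum_distrib_left
    by (subst sum.swap) (use g \<chi> in \<open>simp add: is_char_mult mult_ac\<close>)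
  \<comment> \<open>This is Fourier inversion for \<open>h\<close> at \<open>g\<close>; as
    \<open>h g\<close> is nonzero, not all coefficients vanish.\<close>
  finally obtain i where i: "H i \<noteq> 0"
    using g(2) by (metis (no_types, lifting) mult_zero_right sum.neutral)
  have "l * H i = (\<Sum>g\<in>carrier G. (\<Sum>a\<in>carrier G. of_int (u a) * h (g \<otimes> a)) * \<chi> i (inv g))"
    by (simp add: H_def sum_distrib_left h mult_ac)
  also have "\<dots> = (\<Sum>a\<in>carrier G. \<Sum>g\<in>carrier G. of_int (u a) * (h (a \<otimes> g) * \<chi> i (inv g)))"
    unfolding sum_distrib_right by (subst sum.swap) (simp add: mult_ac m_comm)
  \<comment> \<open>Translating \<open>h\<close> by \<open>a\<close> multiplies its Fourier
    coefficient by \<open>\<chi> i a\<close>.\<close>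
  also have "\<dots> = (\<Sum>a\<in>carrier G. of_int (u a) * (\<chi> i a * H i))"
  proof (rule sum.cong[OF HOL.refl])
    fix a assume a: "a \<in> carrier G"
    have "(\<Sum>g\<in>carrier G. h (a \<otimes> g) * \<chi> i (inv g))
        = (\<Sum>g\<in>carrier G. h (a \<otimes> g) * (\<chi> i a * \<chi> i (inv (a \<otimes> g))))"
    proof (rule sum.cong[OF HOL.refl])
      fix g assume g: "g \<in> carrier G"
      have "inv g = a \<otimes> inv (a \<otimes> g)"
        using a g by (simp add: inv_mult m_assoc[symmetric])
      then have "\<chi> i (inv g) = \<chi> i a * \<chi> i (inv (a \<otimes> g))"
        using \<chi> a g by (metis is_char_mult inv_closed m_closed)
      then show "h (a \<otimes> g) * \<chi> i (inv g) = h (a \<otimes> g) * (\<chi> i a * \<chi> i (inv (a \<otimes> g)))" by simp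
    qed
    also have "\<dots> = (\<Sum>g\<in>carrier G. h g * (\<chi> i a * \<chi> i (inv g)))"
      by (rule sum_translate[OF a])
    also have "\<dots> = \<chi> i a * H i" by (simp add: H_def sum_distrib_left mult_ac)
    finally show "(\<Sum>g\<in>carrier G. of_int (u a) * (h (a \<otimes> g) * \<chi> i (inv g)))
        = of_int (u a) * (\<chi> i a * H i)"
      by (simp add: sum_distrib_left[symmetric])
  qed
  also have "\<dots> = char_sum u (\<chi> i) * H i" by (simp add: char_sum_def sum_distrib_right mult.assoc)
  finally have "l = char_sum u (\<chi> i)" using i by simp
  then show "\<exists>\<chi>. is_char \<chi> \<and> l = char_sum u \<chi>" using \<chi> by blast
qed

section \<open>Power invariance and the integrality of character sums\<close>

definition power_invariant :: "('a \<Rightarrow> int) \<Rightarrow> bool" where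
  "power_invariant u \<longleftrightarrow> (\<exists>M. \<forall>p>M. prime p \<longrightarrow> (\<forall>a\<in>carrier G. u (a [^] (p::nat)) = u a))"

text \<open>The exponent \<open>k\<close> may be replaced by a member of its class modulo
  \<open>ord a\<close> all of whose prime factors exceed the bound \<open>M\<close>; invariance then
  applies one prime factor at a time.\<close>

lemma power_invariant_coprime:
  assumes "power_invariant u" "a \<in> carrier G" "coprime k (ord a)"
  shows "u (a [^] (k::nat)) = u a"
proof -
  obtain M where M: "\<And>p a. p > M \<Longrightarrow> prime p \<Longrightarrow> a \<in> carrier G \<Longrightarrow> u (a [^] (p::nat)) = u a"
    using assms(1) unfolding power_invariant_def by blast
  obtain j where j: "k + ord a * j > 0" "\<And>p. prime p \<Longrightarrow> p dvd k + ord a * j \<Longrightarrow> p > M"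
    using exists_coprime_in_progression[OF assms(3)] by blast
  have "u (b [^] q) = u b" if "q > 0" "\<And>p. prime p \<Longrightarrow> p dvd q \<Longrightarrow> p > M" "b \<in> carrier G" for q b
    using that
  proof (induction q arbitrary: b rule: less_induct)
    case (less q)
    show ?case
    proof (cases "q = 1")
      case False
      then obtain p where p: "prime p" "p dvd q" using prime_factor_nat by blast
      then obtain e where e: "q = p * e" by auto
      have "e < q" "e > 0" using e less.prems(1) prime_gt_1_nat[OF p(1)] by auto
      have "u (b [^] q) = u ((b [^] p) [^] e)" using less.prems by (simp add: e nat_pow_pow)
      also have "\<dots> = u (b [^] p)"
        using \<open>e < q\<close> \<open>e > 0\<close> less.prems e by (intro less.IH) auto
      also have "\<dots> = u b" using less.prems p by (intro M) auto
      finally show ?thesis .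
    qed (use less.prems in simp)
  qed
  from this[OF j assms(2)] have "u (a [^] (k + ord a * j)) = u a" .
  moreover have "a [^] (k + ord a * j) = a [^] k"
    using assms(2) by (simp add: nat_pow_mult[symmetric] nat_pow_pow[symmetric])
  ultimately show ?thesis by simp
qed

lemma same_generate_eq:
  assumes "a \<in> carrier G"
  shows "{b \<in> carrier G. generate G {b} = generate G {a}}
    = (\<lambda>k. a [^] k) ` {k. k \<in> {1..ord a} \<and> coprime k (ord a)}"
proof (intro equalityI subsetI)
  have o: "ord a > 0" using ord_ge_1[OF fin assms] by simp
  fix b assume "b \<in> {b \<in> carrier G. generate G {b} = generate G {a}}"
  then have b: "b \<in> carrier G" "generate G {b} = generate G {a}" by auto
  then have "b \<in> generate G {a}" by (metis generate.incl insertI1)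
  then obtain j :: nat where j: "b = a [^] j"
    using generate_pow_on_finite_carrier[OF fin assms] by auto
  \<comment> \<open>The residue 0 is represented by \<open>ord a\<close> to keep the exponent in
    \<open>{1..ord a}\<close>; it occurs only when \<open>a\<close> is the identity.\<close>
  define k where "k = (if j mod ord a = 0 then ord a else j mod ord a)"
  have "a [^] k = a [^] (j mod ord a)" using assms by (simp add: k_def)
  also have "\<dots> = a [^] (j mod ord a + ord a * (j div ord a))"
    unfolding nat_pow_mult[OF assms, symmetric] nat_pow_pow[OF assms, symmetric]
    using assms by simp
  also have "\<dots> = b" using j by simp
  finally have bk: "b = a [^] k" by simp
  have k: "k \<in> {1..ord a}" using o by (auto simp: k_def Suc_le_eq less_imp_le)
  have "ord b = ord a" using b assms by (simp add: generate_pow_card)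
  then have "ord a div gcd (ord a) k = ord a" using ord_pow_gen[OF assms, of k] k bk by auto
  then have "gcd (ord a) k = 1" using o
    by (metis div_by_1 div_eq_dividend_iff gcd_pos_nat less_numeral_extra(3))
  then have "coprime k (ord a)" by (simp add: coprime_iff_gcd_eq_1 gcd.commute)
  then show "b \<in> (\<lambda>k. a [^] k) ` {k. k \<in> {1..ord a} \<and> coprime k (ord a)}"
    using bk k by auto
next
  fix b assume "b \<in> (\<lambda>k. a [^] k) ` {k. k \<in> {1..ord a} \<and> coprime k (ord a)}"
  then obtain k where k: "b = a [^] k" "k \<in> {1..ord a}" "coprime k (ord a)" by auto
  have b: "b \<in> carrier G" using k assms by simp
  have "ord b = ord a" using ord_pow_gen[OF assms, of k] k
    by (auto simp: coprime_iff_gcd_eq_1 gcd.commute)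
  then have "card (generate G {b}) = card (generate G {a})"
    using b assms by (simp add: generate_pow_card)
  moreover have "generate G {b} \<subseteq> generate G {a}"
    unfolding generate_pow_on_finite_carrier[OF fin assms] generate_pow_on_finite_carrier[OF fin b]
    using assms by (auto simp: nat_pow_pow k(1))
  moreover have "finite (generate G {a})"
    using generate_incl[of "{a}"] assms finite_subset[OF _ fin] by auto
  ultimately have "generate G {b} = generate G {a}" using card_subset_eq by blast
  then show "b \<in> {b \<in> carrier G. generate G {b} = generate G {a}}" using b by simp
qed

text \<open>Elements are grouped by the cyclic subgroup that they generate. On each block
  \<open>u\<close> is constant, and the block contributes an integer times a Ramanujan sum at the
  root of unity \<open>\<chi> a\<close>.\<close>

lemma char_sum_Ints:
  assumes u: "power_invariant u" and \<chi>: "is_char \<chi>"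
  shows "char_sum u \<chi> \<in> \<int>"
proof -
  let ?g = "\<lambda>a. generate G {a}"
  have "char_sum u \<chi> = (\<Sum>H\<in>?g ` carrier G. \<Sum>b | b \<in> carrier G \<and> ?g b = H. of_int (u b) * \<chi> b)"
    unfolding char_sum_def by (rule sum.image_gen) simp
  also have "\<dots> \<in> \<int>"
  proof (rule Ints_sum)
    fix H assume "H \<in> ?g ` carrier G"
    then obtain a where a: "a \<in> carrier G" "H = ?g a" by auto
    let ?K = "{k. k \<in> {1..ord a} \<and> coprime k (ord a)}"
    have "inj_on (\<lambda>k. a [^] k) ?K"
      by (rule inj_on_subset[OF ord_inj'[OF a(1)]]) auto
    then have "(\<Sum>b | b \<in> carrier G \<and> ?g b = H. of_int (u b) * \<chi> b)
        = (\<Sum>k\<in>?K. of_int (u (a [^] k)) * \<chi> (a [^] k))"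
      unfolding a(2) same_generate_eq[OF a(1)] by (simp add: sum.reindex)
    also have "\<dots> = of_int (u a) * (\<Sum>k\<in>?K. \<chi> a ^ k)"
      unfolding sum_distrib_left
      by (intro sum.cong) (auto simp: power_invariant_coprime[OF u a(1)] is_char_pow[OF \<chi> a(1)])
    also have "\<dots> \<in> \<int>"
    proof (intro Ints_mult Ints_of_int ramanujan_sum_Ints)
      show "ord a > 0" using ord_ge_1[OF fin a(1)] by simp
      show "\<chi> a ^ ord a = 1"
        using is_char_pow[OF \<chi> a(1), of "ord a"] \<chi> a(1) by (simp add: is_char_def)
    qed
    finally show "(\<Sum>b | b \<in> carrier G \<and> ?g b = H. of_int (u b) * \<chi> b) \<in> \<int>" .
  qed
  finally show ?thesis .
qed

section \<open>Congruences modulo a prime in the integral group ring\<close>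

text \<open>The image of the integral group ring under a family of characters.\<close>

inductive_set char_ring :: "('i \<Rightarrow> 'a \<Rightarrow> complex) \<Rightarrow> ('i \<Rightarrow> complex) set"
  for \<chi> :: "'i \<Rightarrow> 'a \<Rightarrow> complex" where
  gen: "b \<in> carrier G \<Longrightarrow> (\<lambda>i. \<chi> i b) \<in> char_ring \<chi>"
| zero: "(\<lambda>_. 0) \<in> char_ring \<chi>"
| add: "s \<in> char_ring \<chi> \<Longrightarrow> t \<in> char_ring \<chi> \<Longrightarrow> (\<lambda>i. s i + t i) \<in> char_ring \<chi>"
| neg: "s \<in> char_ring \<chi> \<Longrightarrow> (\<lambda>i. - s i) \<in> char_ring \<chi>"

lemma char_ring_diff:
  assumes "s \<in> char_ring \<chi>" "t \<in> char_ring \<chi>"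
  shows "(\<lambda>i. s i - t i) \<in> char_ring \<chi>"
  using char_ring.add[OF assms(1) char_ring.neg[OF assms(2)]] by simp

lemma char_ring_of_int_mult:
  assumes "s \<in> char_ring \<chi>"
  shows "(\<lambda>i. of_int z * s i) \<in> char_ring \<chi>"
proof (induction z rule: int_induct[where k = 0])
  case base
  then show ?case by (simp add: char_ring.zero)
next
  case (step1 z)
  then show ?case using char_ring.add[OF step1(2) assms] by (simp add: algebra_simps)
next
  case (step2 z)
  then show ?case using char_ring_diff[OF step2(2) assms] by (simp add: algebra_simps)
qed

lemma char_ring_sum:
  assumes "\<And>k. k \<in> K \<Longrightarrow> s k \<in> char_ring \<chi>"
  shows "(\<lambda>i. \<Sum>k\<in>K. s k i) \<in> char_ring \<chi>"
  using assms by (induction K rule: infinite_finite_induct) (auto intro: char_ring.zero char_ring.add)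

lemma char_ring_mult:
  assumes \<chi>: "\<And>i. is_char (\<chi> i)" and s: "s \<in> char_ring \<chi>" and t: "t \<in> char_ring \<chi>"
  shows "(\<lambda>i. s i * t i) \<in> char_ring \<chi>"
  using s
proof induction
  case (gen b)
  note b = gen
  show ?case using t
  proof induction
    case (gen c)
    then show ?case using char_ring.gen[of "b \<otimes> c" \<chi>] b \<chi> by (simp add: is_char_mult)
  next
    case (add s t)
    then show ?case using char_ring.add[OF add.IH] by (simp add: algebra_simps)
  next
    case (neg s)
    then show ?case using char_ring.neg[OF neg.IH] by simp
  qed (simp add: char_ring.zero)
next
  case (add s t)
  then show ?case using char_ring.add[OF add.IH] by (simp add: algebra_simps)
next
  case (neg s)
  then show ?case using char_ring.neg[OF neg.IH] by simp
qed (simp add: char_ring.zero)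

lemma char_ring_one:
  assumes "\<And>i. is_char (\<chi> i)"
  shows "(\<lambda>_. 1) \<in> char_ring \<chi>"
  using char_ring.gen[of \<one> \<chi>] assms by (simp add: is_char_def)

lemma char_ring_power:
  assumes \<chi>: "\<And>i. is_char (\<chi> i)" and s: "s \<in> char_ring \<chi>"
  shows "(\<lambda>i. s i ^ k) \<in> char_ring \<chi>"
  by (induction k) (simp_all add: char_ring_one[OF \<chi>] char_ring_mult[OF \<chi> s])

text \<open>Needed for the interpolation quotient: if \<open>l ^ p - l = p * poly r l\<close> at the
  eigenvalues, the quotient still comes from the integral group ring.\<close>

lemma char_ring_poly:
  fixes r :: "int poly"
  assumes \<chi>: "\<And>i. is_char (\<chi> i)" and s: "(\<lambda>i. of_int (l i)) \<in> char_ring \<chi>"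
  shows "(\<lambda>i. of_int (poly r (l i))) \<in> char_ring \<chi>"
proof (induction r)
  case 0
  then show ?case by (simp add: char_ring.zero)
next
  case (pCons a r)
  have "(\<lambda>i. of_int a * 1) \<in> char_ring \<chi>"
    by (intro char_ring_of_int_mult char_ring_one \<chi>)
  from char_ring.add[OF this char_ring_mult[OF \<chi> s pCons.IH]] show ?case by simp
qed

text \<open>Pairing with the coefficients of the delta expansion reads off the coefficient of a
  group ring element at the identity.\<close>

lemma char_ring_coefficient_Ints:
  assumes delta: "\<And>a. a \<in> carrier G \<Longrightarrow> (\<Sum>i\<in>I. c i * \<chi> i a) = (if a = \<one> then 1 else 0)"
    and s: "s \<in> char_ring \<chi>"
  shows "(\<Sum>i\<in>I. c i * s i) \<in> \<int>"
  using s
proof induction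
  case (add s t)
  then show ?case by (simp add: distrib_left sum.distrib)
next
  case (neg s)
  then show ?case by (simp add: sum_negf)
qed (simp_all add: delta)

text \<open>The Frobenius congruence, built up one group element at a time. The error
  \<open>\<rho>\<close> is kept in the ring explicitly, because divisibility by \<open>p\<close>
  says nothing about complex values alone.\<close>

lemma char_ring_frobenius:
  assumes \<chi>: "\<And>i. is_char (\<chi> i)" and p: "prime p" and "finite B" "B \<subseteq> carrier G"
  shows "\<exists>\<rho>\<in>char_ring \<chi>. \<forall>i. (\<Sum>a\<in>B. of_int (u a) * \<chi> i a) ^ p
    = (\<Sum>a\<in>B. of_int (u a) * \<chi> i (a [^] p)) + of_nat p * \<rho> i"
  using assms(3,4)
proof (induction B)
  case empty
  show ?case using p by (intro bexI[of _ "\<lambda>_. 0"]) (auto simp: char_ring.zero prime_gt_0_nat)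
next
  case (insert b B)
  then have b: "b \<in> carrier G" "B \<subseteq> carrier G" by auto
  obtain \<rho> where \<rho>: "\<rho> \<in> char_ring \<chi>" "\<And>i. (\<Sum>a\<in>B. of_int (u a) * \<chi> i a) ^ p
      = (\<Sum>a\<in>B. of_int (u a) * \<chi> i (a [^] p)) + of_nat p * \<rho> i"
    using insert by auto
  obtain c where c: "\<And>x y :: complex. (x + y) ^ p
      = x ^ p + y ^ p + of_nat p * (\<Sum>k\<in>{1..<p}. of_nat (c k) * x ^ k * y ^ (p - k))"
    using prime_binomial_expansion[OF p] by blast
  obtain t where t: "u b ^ p - u b = int p * t"
    using prime_dvd_power_minus_self_int[OF p, of "u b"] by (auto elim: dvdE)
  define X where "X = (\<lambda>i. of_int (u b) * \<chi> i b)"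
  define Y where "Y = (\<lambda>i. \<Sum>a\<in>B. of_int (u a) * \<chi> i a)"
  define Q where "Q = (\<lambda>i. \<Sum>k\<in>{1..<p}. of_int (int (c k)) * (X i ^ k * Y i ^ (p - k)))"
  have X: "X \<in> char_ring \<chi>" unfolding X_def by (intro char_ring_of_int_mult char_ring.gen b)
  have Y: "Y \<in> char_ring \<chi>"
    unfolding Y_def using b by (intro char_ring_sum char_ring_of_int_mult char_ring.gen) auto
  have Q: "Q \<in> char_ring \<chi>"
    unfolding Q_def
    by (intro char_ring_sum char_ring_of_int_mult char_ring_mult[OF \<chi>] char_ring_power[OF \<chi>] X Y)
  \<comment> \<open>The three errors come from Fermat's congruence for \<open>u b\<close>, from the
    induction hypothesis and from the mixed binomial terms.\<close>
  define \<rho>' where "\<rho>' = (\<lambda>i. (of_int t * \<chi> i (b [^] p) + \<rho> i) + Q i)"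
  have "\<rho>' \<in> char_ring \<chi>"
    unfolding \<rho>'_def using b by (intro char_ring.add char_ring_of_int_mult char_ring.gen \<rho> Q) auto
  moreover have "(\<Sum>a\<in>insert b B. of_int (u a) * \<chi> i a) ^ p
      = (\<Sum>a\<in>insert b B. of_int (u a) * \<chi> i (a [^] p)) + of_nat p * \<rho>' i" for i
  proof -
    have ub: "of_int (u b) ^ p = of_int (u b) + of_nat p * (of_int t :: complex)"
    proof -
      have "u b ^ p = u b + int p * t" using t by simp
      then have "(of_int (u b ^ p) :: complex) = of_int (u b + int p * t)" by (rule arg_cong)
      then show ?thesis by simp
    qed
    have "(\<Sum>a\<in>insert b B. of_int (u a) * \<chi> i a) ^ p = (X i + Y i) ^ p"
      using insert.hyps by (simp add: X_def Y_def)
    also have "\<dots> = X i ^ p + Y i ^ p + of_nat p * Q i"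
      by (simp add: c Q_def mult.assoc)
    also have "X i ^ p = of_int (u b) * \<chi> i (b [^] p) + of_nat p * (of_int t * \<chi> i (b [^] p))"
      using is_char_pow[OF \<chi> b(1)] by (simp add: X_def power_mult_distrib ub algebra_simps)
    also have "Y i ^ p = (\<Sum>a\<in>B. of_int (u a) * \<chi> i (a [^] p)) + of_nat p * \<rho> i"
      by (simp add: Y_def \<rho>(2))
    finally show ?thesis using insert.hyps by (simp add: \<rho>'_def algebra_simps)
  qed
  ultimately show ?case by blast
qed

text \<open>The order of \<open>a \<otimes> inv b\<close> divides both \<open>k\<close> and the
  group order.\<close>

lemma pow_inj_coprime:
  assumes "coprime k (Coset.order G)" "a \<in> carrier G" "b \<in> carrier G" "a [^] k = b [^] (k::nat)"
  shows "a = b"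
proof -
  have "(a \<otimes> inv b) [^] k = \<one>"
    using assms by (simp add: pow_mult_distrib m_comm nat_pow_inv)
  then have "ord (a \<otimes> inv b) dvd k" using assms by (simp add: pow_eq_id)
  moreover have "ord (a \<otimes> inv b) dvd Coset.order G" using assms by (simp add: ord_dvd_group_order)
  ultimately have "ord (a \<otimes> inv b) = 1"
    using assms(1) by (meson coprime_common_divisor_nat nat_dvd_1_iff_1 coprime_def)
  then have "a \<otimes> inv b = \<one>" using assms ord_eq_1[of "a \<otimes> inv b"] by simp
  then show ?thesis using assms by (metis inv_closed inv_equality inv_inv)
qed

text \<open>The coefficient at \<open>b [^] p\<close> of the \<open>p\<close>-th power of
  \<open>u\<close> in the group ring is computed twice modulo \<open>p\<close>: interpolation gives
  \<open>u (b [^] p)\<close>, Frobenius gives \<open>u b\<close>.\<close>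

lemma power_invariantI_char_sum_Ints:
  assumes u: "\<And>\<chi>. is_char \<chi> \<Longrightarrow> char_sum u \<chi> \<in> \<int>"
  shows "power_invariant u"
proof -
  obtain N :: nat and c \<chi> where \<chi>: "\<And>i. is_char (\<chi> i)"
    and delta: "\<And>a. a \<in> carrier G \<Longrightarrow> (\<Sum>i<N. c i * \<chi> i a) = (if a = \<one> then 1 else 0)"
    by (rule delta_character_expansion) blast
  have "\<forall>i. \<exists>m. char_sum u (\<chi> i) = of_int m" using u[OF \<chi>] by (auto elim: Ints_cases)
  then obtain l where l: "\<And>i. char_sum u (\<chi> i) = of_int (l i)" by (auto dest: choice)
  define L where "L = l ` {..<N}"
  \<comment> \<open>The bound \<open>M\<close> serves three purposes. For a prime
    \<open>p > M\<close>, congruent values of \<open>u\<close> are equal, distinct eigenvalues are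
    incongruent, and \<open>p\<close> is coprime to the group order.\<close>
  have "finite ((\<lambda>(a, b). nat \<bar>u a - u b\<bar>) ` (carrier G \<times> carrier G)
      \<union> (\<lambda>(m, m'). nat \<bar>m - m'\<bar>) ` (L \<times> L) \<union> {Coset.order G})"
    by (simp add: L_def)
  then obtain M where "\<forall>x\<in>((\<lambda>(a, b). nat \<bar>u a - u b\<bar>) ` (carrier G \<times> carrier G)
      \<union> (\<lambda>(m, m'). nat \<bar>m - m'\<bar>) ` (L \<times> L) \<union> {Coset.order G}). x < M"
    unfolding finite_nat_set_iff_bounded by blast
  then have M: "\<And>a b. a \<in> carrier G \<Longrightarrow> b \<in> carrier G \<Longrightarrow> \<bar>u a - u b\<bar> < int M"
    "\<And>m m'. m \<in> L \<Longrightarrow> m' \<in> L \<Longrightarrow> \<bar>m - m'\<bar> < int M" "Coset.order G < M"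
    by (auto simp: nat_less_iff ball_Un)
  have "u (b [^] p) = u b" if p: "prime p" "p > M" and b: "b \<in> carrier G" for p b
  proof -
    define g where "g = b [^] p"
    have g: "g \<in> carrier G" using b by (simp add: g_def)
    have ord: "Coset.order G > 0" by (simp add: order_gt_0_iff_finite)
    have cop: "coprime p (Coset.order G)"
      using p M(3) ord by (intro prime_imp_coprime) (auto dest: dvd_imp_le)
    have small: "z = 0" if "int p dvd z" "\<bar>z\<bar> < int M" for z :: int
      using that p(2) dvd_imp_le_int[of z "int p"] by force
    \<comment> \<open>Interpolation of \<open>X ^ p - X\<close> at the integer eigenvalues, where it
      takes multiples of \<open>p\<close> by Fermat.\<close>
    have "\<exists>r. \<forall>m\<in>L. poly (monom 1 p - monom 1 1 :: int poly) m = int p * poly r m"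
    proof (rule poly_multiple_on_incongruent_set)
      show "int p dvd poly (monom 1 p - monom 1 1) m" for m
        using prime_dvd_power_minus_self_int[OF p(1)] by (simp add: poly_monom)
      show "\<not> int p dvd m - m'" if "m \<in> L" "m' \<in> L" "m \<noteq> m'" for m m'
        using small[of "m - m'"] M(2)[of m m'] that by auto
    qed (use p in \<open>auto simp: L_def\<close>)
    then obtain r where r: "\<And>i. i < N \<Longrightarrow> l i ^ p - l i = int p * poly r (l i)"
      by (auto simp: poly_monom L_def)
    obtain \<rho> where \<rho>: "\<rho> \<in> char_ring \<chi>" "\<And>i. (\<Sum>a\<in>carrier G. of_int (u a) * \<chi> i a) ^ p
        = (\<Sum>a\<in>carrier G. of_int (u a) * \<chi> i (a [^] p)) + of_nat p * \<rho> i"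
      using char_ring_frobenius[of \<chi> p "carrier G" u] \<chi> p(1) by auto
    \<comment> \<open>\<open>E\<close> multiplies by the inverse of \<open>g\<close> and takes the
      coefficient at the identity, so it extracts the coefficient at \<open>g\<close>.\<close>
    define E where "E = (\<lambda>s. \<Sum>i<N. c i * (s i * \<chi> i (inv g)))"
    have E_Ints: "E s \<in> \<int>" if "s \<in> char_ring \<chi>" for s
      unfolding E_def
      by (rule char_ring_coefficient_Ints[OF delta char_ring_mult[OF \<chi> that char_ring.gen]])
        (use g in auto)
    have E_lin: "E (\<lambda>i. s i + of_nat p * t i) = E s + of_nat p * E t" for s t
      by (simp add: E_def algebra_simps sum.distrib sum_distrib_left)
    \<comment> \<open>Used with the identity map and \<open>a0 = g\<close>, and with the
      \<open>p\<close>-th power map and \<open>a0 = b\<close>; injectivity of the latter makes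
      \<open>b\<close> the only preimage of \<open>g\<close>.\<close>
    have E_coeff: "E (\<lambda>i. \<Sum>a\<in>carrier G. of_int (u a) * \<chi> i (f a)) = of_int (u a0)"
      if f: "\<And>a. a \<in> carrier G \<Longrightarrow> f a \<in> carrier G" "\<And>a. a \<in> carrier G \<Longrightarrow> f a = g \<longleftrightarrow> a = a0"
        and a0: "a0 \<in> carrier G" for f a0
    proof -
      have "E (\<lambda>i. \<Sum>a\<in>carrier G. of_int (u a) * \<chi> i (f a))
          = (\<Sum>i<N. \<Sum>a\<in>carrier G. of_int (u a) * (c i * \<chi> i (f a \<otimes> inv g)))"
        unfolding E_def sum_distrib_left sum_distrib_right
        using \<chi> f(1) g by (intro sum.cong HOL.refl) (simp add: is_char_mult)
      also have "\<dots> = (\<Sum>a\<in>carrier G. of_int (u a) * (\<Sum>i<N. c i * \<chi> i (f a \<otimes> inv g)))"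
        unfolding sum_distrib_left by (rule sum.swap)
      also have "\<dots> = (\<Sum>a\<in>carrier G. if a = a0 then of_int (u a) else 0)"
      proof (rule sum.cong[OF HOL.refl])
        fix a assume a: "a \<in> carrier G"
        have "f a \<otimes> inv g = \<one> \<longleftrightarrow> f a = g"
          using g f(1)[OF a] by (metis inv_closed inv_equality inv_inv r_inv)
        then show "of_int (u a) * (\<Sum>i<N. c i * \<chi> i (f a \<otimes> inv g))
            = (if a = a0 then of_int (u a) else 0)"
          using delta[of "f a \<otimes> inv g"] f(1)[OF a] f(2)[OF a] g by simp
      qed
      also have "\<dots> = of_int (u a0)" using a0 by simp
      finally show ?thesis .
    qed
    have lR: "(\<lambda>i. of_int (l i)) \<in> char_ring \<chi>"
      unfolding l[symmetric] char_sum_def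
      by (intro char_ring_sum char_ring_of_int_mult char_ring.gen)
    have "E (\<lambda>i. of_int (l i ^ p)) = E (\<lambda>i. of_int (l i) + of_nat p * of_int (poly r (l i)))"
    proof -
      have "of_int (l i ^ p) = (of_int (l i) + of_nat p * of_int (poly r (l i)) :: complex)"
        if "i < N" for i
      proof -
        have "l i ^ p = l i + int p * poly r (l i)" using r[OF that] by simp
        then have "(of_int (l i ^ p) :: complex) = of_int (l i + int p * poly r (l i))"
          by (rule arg_cong)
        then show ?thesis by simp
      qed
      then show ?thesis unfolding E_def by (intro sum.cong) auto
    qed
    also have "\<dots> = E (\<lambda>i. \<Sum>a\<in>carrier G. of_int (u a) * \<chi> i a)
        + of_nat p * E (\<lambda>i. of_int (poly r (l i)))"
      by (simp add: E_lin l[symmetric] char_sum_def)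
    also have "E (\<lambda>i. \<Sum>a\<in>carrier G. of_int (u a) * \<chi> i a) = of_int (u g)"
      by (rule E_coeff) (use g in auto)
    finally have 1: "E (\<lambda>i. of_int (l i ^ p)) = of_int (u g) + of_nat p * E (\<lambda>i. of_int (poly r (l i)))" .
    have "E (\<lambda>i. of_int (l i ^ p))
        = E (\<lambda>i. (\<Sum>a\<in>carrier G. of_int (u a) * \<chi> i (a [^] p)) + of_nat p * \<rho> i)"
      by (simp add: \<rho>(2)[symmetric] l[symmetric] char_sum_def)
    also have "\<dots> = of_int (u b) + of_nat p * E \<rho>"
      unfolding E_lin
      by (subst E_coeff) (use b pow_inj_coprime[OF cop] in \<open>auto simp: g_def\<close>)
    finally have 2: "of_int (u b) - of_int (u g)
        = of_nat p * (E (\<lambda>i. of_int (poly r (l i))) - E \<rho>)"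
      using 1 by (simp add: algebra_simps)
    \<comment> \<open>Integrality of this factor turns the complex identity into a congruence modulo
      \<open>p\<close>.\<close>
    have "E (\<lambda>i. of_int (poly r (l i))) - E \<rho> \<in> \<int>"
      by (intro Ints_diff E_Ints \<rho>(1) char_ring_poly[OF \<chi> lR])
    then obtain z where "E (\<lambda>i. of_int (poly r (l i))) - E \<rho> = of_int z"
      by (auto elim: Ints_cases)
    with 2 have "(of_int (u b - u g) :: complex) = of_int (int p * z)" by simp
    then have "u b - u g = int p * z" by (simp only: of_int_eq_iff)
    then have "int p dvd u b - u g" by simp
    with small M(1)[OF b g] have "u b - u g = 0" by blast
    then show ?thesis by (simp add: g_def)
  qed
  then show ?thesis unfolding power_invariant_def by (intro exI[of _ M]) simp
qed

lemma conv_eigenvalues_Ints_iff: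
  "(\<forall>l. conv_eigenvalue u l \<longrightarrow> l \<in> \<int>) \<longleftrightarrow> power_invariant u"
proof
  assume "\<forall>l. conv_eigenvalue u l \<longrightarrow> l \<in> \<int>"
  then show "power_invariant u"
    by (intro power_invariantI_char_sum_Ints) (auto simp: conv_eigenvalue_iff_char_sum)
qed (auto simp: conv_eigenvalue_iff_char_sum char_sum_Ints)

end


section \<open>Distances in Cayley graphs\<close>

lemma is_walk_map:
  assumes "is_walk \<Gamma> u p v" "\<And>a. a \<in> vertices \<Gamma> \<Longrightarrow> \<sigma> a \<in> vertices \<Gamma>"
    and "\<And>a b. a \<in> vertices \<Gamma> \<Longrightarrow> b \<in> vertices \<Gamma> \<Longrightarrow> {a, b} \<in> edges \<Gamma> \<Longrightarrow> {\<sigma> a, \<sigma> b} \<in> edges \<Gamma>"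
  shows "is_walk \<Gamma> (\<sigma> u) (map \<sigma> p) (\<sigma> v)"
proof -
  have p: "p \<noteq> []" "set p \<subseteq> vertices \<Gamma>" "hd p = u" "last p = v"
    "successively (\<lambda>a b. {a, b} \<in> edges \<Gamma>) p"
    using assms(1) by (auto simp: is_walk_def)
  have "successively (\<lambda>a b. {\<sigma> a, \<sigma> b} \<in> edges \<Gamma>) p"
    by (rule successively_mono[OF p(5)]) (use p(2) assms(3) in auto)
  then show ?thesis
    using p assms(2) by (auto simp: is_walk_def successively_map hd_map last_map)
qed

lemma graph_dist_automorphism:
  assumes \<sigma>: "bij_betw \<sigma> (vertices \<Gamma>) (vertices \<Gamma>)"
    and edges: "\<And>a b. a \<in> vertices \<Gamma> \<Longrightarrow> b \<in> vertices \<Gamma> \<Longrightarrow>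
      {\<sigma> a, \<sigma> b} \<in> edges \<Gamma> \<longleftrightarrow> {a, b} \<in> edges \<Gamma>"
    and uv: "u \<in> vertices \<Gamma>" "v \<in> vertices \<Gamma>"
  shows "graph_dist \<Gamma> (\<sigma> u) (\<sigma> v) = graph_dist \<Gamma> u v"
proof -
  define \<tau> where "\<tau> = inv_into (vertices \<Gamma>) \<sigma>"
  have \<sigma>V: "\<sigma> a \<in> vertices \<Gamma>" if "a \<in> vertices \<Gamma>" for a using \<sigma> that by (auto dest: bij_betwE)
  have \<tau>V: "\<tau> a \<in> vertices \<Gamma>" "\<sigma> (\<tau> a) = a" if "a \<in> vertices \<Gamma>" for a
    using \<sigma> that unfolding \<tau>_def by (auto simp: bij_betw_def f_inv_into_f inv_into_into)
  have \<tau>\<sigma>: "\<tau> (\<sigma> a) = a" if "a \<in> vertices \<Gamma>" for a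
    using \<sigma> that unfolding \<tau>_def by (simp add: bij_betw_def)
  have "(\<exists>p. is_walk \<Gamma> (\<sigma> u) p (\<sigma> v) \<and> length p = Suc n) \<longleftrightarrow>
      (\<exists>p. is_walk \<Gamma> u p v \<and> length p = Suc n)" for n
  proof
    assume "\<exists>p. is_walk \<Gamma> (\<sigma> u) p (\<sigma> v) \<and> length p = Suc n"
    then obtain p where p: "is_walk \<Gamma> (\<sigma> u) p (\<sigma> v)" "length p = Suc n" by auto
    have "is_walk \<Gamma> (\<tau> (\<sigma> u)) (map \<tau> p) (\<tau> (\<sigma> v))"
      by (rule is_walk_map[OF p(1)]) (use \<tau>V edges in \<open>metis\<close>)+
    then show "\<exists>p. is_walk \<Gamma> u p v \<and> length p = Suc n"
      using p(2) uv \<tau>\<sigma> by (intro exI[of _ "map \<tau> p"]) simp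
  next
    assume "\<exists>p. is_walk \<Gamma> u p v \<and> length p = Suc n"
    then obtain p where p: "is_walk \<Gamma> u p v" "length p = Suc n" by auto
    have "is_walk \<Gamma> (\<sigma> u) (map \<sigma> p) (\<sigma> v)"
      by (rule is_walk_map[OF p(1)]) (use \<sigma>V edges in auto)
    then show "\<exists>p. is_walk \<Gamma> (\<sigma> u) p (\<sigma> v) \<and> length p = Suc n"
      using p(2) by (intro exI[of _ "map \<sigma> p"]) simp
  qed
  then show ?thesis by (simp add: graph_dist_def)
qed

lemma is_walk_rev:
  assumes "is_walk \<Gamma> u p v"
  shows "is_walk \<Gamma> v (rev p) u"
  using assms by (auto simp: is_walk_def hd_rev last_rev insert_commute)

lemma graph_dist_commute: "graph_dist \<Gamma> u v = graph_dist \<Gamma> v u"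
proof -
  have "(\<exists>p. is_walk \<Gamma> u p v \<and> length p = Suc n) \<longleftrightarrow> (\<exists>p. is_walk \<Gamma> v p u \<and> length p = Suc n)" for n
    by (metis is_walk_rev length_rev)
  then show ?thesis by (simp add: graph_dist_def)
qed

text \<open>\<open>tl q\<close> drops the vertex \<open>v\<close>, with which \<open>p\<close>
  already ends.\<close>

lemma is_walk_append:
  assumes "is_walk \<Gamma> u p v" "is_walk \<Gamma> v q w"
  shows "is_walk \<Gamma> u (p @ tl q) w"
proof (cases q)
  case (Cons a r)
  then show ?thesis
    using assms by (cases r) (auto simp: is_walk_def successively_append_iff)
qed (use assms in \<open>auto simp: is_walk_def\<close>)

text \<open>The given walk ensures that the least length is attained. The condition
  \<open>u \<noteq> v\<close> excludes a loop, whose ends are at distance 0.\<close>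

lemma graph_dist_eq_1_iff:
  assumes "is_walk \<Gamma> u p v"
  shows "graph_dist \<Gamma> u v = 1 \<longleftrightarrow> {u, v} \<in> edges \<Gamma> \<and> u \<noteq> v"
proof -
  let ?P = "\<lambda>n. \<exists>p. is_walk \<Gamma> u p v \<and> length p = Suc n"
  have uv: "u \<in> vertices \<Gamma>" "v \<in> vertices \<Gamma>" using assms by (auto simp: is_walk_def)
  have P0: "?P 0 \<longleftrightarrow> u = v"
  proof
    assume "u = v"
    then have "is_walk \<Gamma> u [u] v" using uv by (simp add: is_walk_def)
    then show "?P 0" by (intro exI[of _ "[u]"]) simp
  qed (auto simp: is_walk_def length_Suc_conv)
  have P1: "?P 1 \<longleftrightarrow> {u, v} \<in> edges \<Gamma>"
  proof
    assume "{u, v} \<in> edges \<Gamma>"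
    then have "is_walk \<Gamma> u [u, v] v" using uv by (simp add: is_walk_def)
    then show "?P 1" by (intro exI[of _ "[u, v]"]) simp
  qed (auto simp: is_walk_def length_Suc_conv)
  have "length p = Suc (length p - 1)" using assms by (cases p) (auto simp: is_walk_def)
  then have "?P (length p - 1)" using assms by blast
  then have least: "?P (graph_dist \<Gamma> u v)" unfolding graph_dist_def by (rule LeastI)
  have le: "graph_dist \<Gamma> u v \<le> n" if "?P n" for n
    unfolding graph_dist_def using that by (rule Least_le)
  show ?thesis
  proof
    assume "graph_dist \<Gamma> u v = 1"
    then show "{u, v} \<in> edges \<Gamma> \<and> u \<noteq> v" using least le[of 0] P0 P1 by auto
  next
    assume "{u, v} \<in> edges \<Gamma> \<and> u \<noteq> v"
    then have "graph_dist \<Gamma> u v \<le> 1" "graph_dist \<Gamma> u v \<noteq> 0"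
      using least le[of 1] P0 P1 by auto
    then show "graph_dist \<Gamma> u v = 1" by linarith
  qed
qed

section \<open>Word length in a connected Cayley graph\<close>

locale cayley_graph = group G for G (structure) +
  fixes S :: "'a set"
  assumes S_closed: "S \<subseteq> carrier G" and S_inv: "set_inv S = S" and one_notin_S: "\<one> \<notin> S"
    and S_gen: "generate G S = carrier G"
begin

abbreviation \<Gamma> where "\<Gamma> \<equiv> Cay G S"

lemma vertices_Cay [simp]: "vertices \<Gamma> = carrier G"
  by (simp add: Cay_def)

lemma inv_mem_S: "s \<in> S \<Longrightarrow> inv s \<in> S"
  using S_inv by (auto simp: SET_INV_def)

text \<open>An unordered edge may be witnessed in either orientation; closure of \<open>S\<close>
  under inverses makes the two conditions agree.\<close>

lemma edge_Cay_iff: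
  assumes "g \<in> carrier G" "h \<in> carrier G"
  shows "{g, h} \<in> edges \<Gamma> \<longleftrightarrow> inv g \<otimes> h \<in> S"
proof -
  have "inv h \<otimes> g = inv (inv g \<otimes> h)" using assms by (simp add: inv_mult_group)
  then have "inv h \<otimes> g \<in> S \<Longrightarrow> inv g \<otimes> h \<in> S"
    using inv_mem_S assms by (metis inv_closed inv_inv m_closed)
  then show ?thesis using assms by (auto simp: Cay_def doubleton_eq_iff)
qed

lemma edge_Cay_translate:
  assumes "g \<in> carrier G" "a \<in> carrier G" "b \<in> carrier G"
  shows "{g \<otimes> a, g \<otimes> b} \<in> edges \<Gamma> \<longleftrightarrow> {a, b} \<in> edges \<Gamma>"
proof -
  have "inv (g \<otimes> a) \<otimes> (g \<otimes> b) = inv a \<otimes> b"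
    using assms by (simp add: inv_mult_group m_assoc) (simp add: m_assoc[symmetric])
  then show ?thesis using assms by (simp add: edge_Cay_iff)
qed

lemma graph_dist_translate:
  assumes "g \<in> carrier G" "u \<in> carrier G" "v \<in> carrier G"
  shows "graph_dist \<Gamma> (g \<otimes> u) (g \<otimes> v) = graph_dist \<Gamma> u v"
proof (rule graph_dist_automorphism)
  show "bij_betw ((\<otimes>) g) (vertices \<Gamma>) (vertices \<Gamma>)"
    by (rule bij_betw_byWitness[where f' = "\<lambda>a. inv g \<otimes> a"])
       (use assms in \<open>auto simp: m_assoc[symmetric]\<close>)
qed (use assms edge_Cay_translate in auto)

text \<open>Word length with respect to \<open>S\<close>. The distance is invariant under left
  translation, so this function determines the distance matrix.\<close>

definition S_length :: "'a \<Rightarrow> nat" where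
  "S_length g = graph_dist \<Gamma> \<one> g"

lemma graph_dist_eq_S_length:
  assumes "u \<in> carrier G" "v \<in> carrier G"
  shows "graph_dist \<Gamma> u v = S_length (inv u \<otimes> v)"
  using graph_dist_translate[of "inv u" u v] assms by (simp add: S_length_def)

lemma S_length_inv:
  assumes "g \<in> carrier G"
  shows "S_length (inv g) = S_length g"
  using graph_dist_eq_S_length[of g \<one>] assms graph_dist_commute[of \<Gamma> g \<one>]
  by (simp add: S_length_def)

text \<open>Such a \<open>\<phi>\<close> is an automorphism of the Cayley graph fixing the
  identity.\<close>

lemma S_length_automorphism:
  assumes \<phi>: "\<phi> \<in> hom G G" "bij_betw \<phi> (carrier G) (carrier G)"
    and S: "\<And>g. g \<in> carrier G \<Longrightarrow> \<phi> g \<in> S \<longleftrightarrow> g \<in> S" and g: "g \<in> carrier G"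
  shows "S_length (\<phi> g) = S_length g"
proof -
  interpret \<phi>: group_hom G G \<phi> by unfold_locales (rule \<phi>)
  have "graph_dist \<Gamma> (\<phi> \<one>) (\<phi> g) = graph_dist \<Gamma> \<one> g"
  proof (rule graph_dist_automorphism)
    fix a b assume "a \<in> vertices \<Gamma>" "b \<in> vertices \<Gamma>"
    then have ab: "a \<in> carrier G" "b \<in> carrier G" by auto
    then have "inv (\<phi> a) \<otimes> \<phi> b = \<phi> (inv a \<otimes> b)" by simp
    then show "{\<phi> a, \<phi> b} \<in> edges \<Gamma> \<longleftrightarrow> {a, b} \<in> edges \<Gamma>"
      using ab S[of "inv a \<otimes> b"] by (simp add: edge_Cay_iff del: \<phi>.hom_mult \<phi>.hom_inv)
  qed (use \<phi>(2) g in auto)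
  then show ?thesis by (simp add: S_length_def)
qed

text \<open>Induction on generation. For a product, the walk to the second factor is translated by
  the first factor and appended.\<close>

lemma walk_from_one:
  assumes "g \<in> carrier G"
  shows "\<exists>p. is_walk \<Gamma> \<one> p g"
proof -
  have walk_S: "is_walk \<Gamma> \<one> [\<one>, s] s" if "s \<in> S" for s
    using that S_closed edge_Cay_iff[of \<one> s] by (auto simp: is_walk_def)
  have "g \<in> generate G S" using assms S_gen by simp
  then show ?thesis
  proof induction
    case one
    show ?case by (intro exI[of _ "[\<one>]"]) (simp add: is_walk_def)
  next
    case (incl h)
    then show ?case using walk_S by blast
  next
    case (inv h)
    then show ?case using walk_S inv_mem_S by blast
  next
    case (eng h1 h2)
    then obtain p q where pq: "is_walk \<Gamma> \<one> p h1" "is_walk \<Gamma> \<one> q h2" by auto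
    have h: "h1 \<in> carrier G" "h2 \<in> carrier G" using eng S_gen by auto
    have "is_walk \<Gamma> (h1 \<otimes> \<one>) (map ((\<otimes>) h1) q) (h1 \<otimes> h2)"
      by (rule is_walk_map[OF pq(2)]) (use h edge_Cay_translate in auto)
    then show ?case using is_walk_append[OF pq(1)] h by auto
  qed
qed

lemma connected_Cay: "connected_sgraph \<Gamma>"
proof -
  have "\<exists>p. is_walk \<Gamma> u p v" if uv: "u \<in> carrier G" "v \<in> carrier G" for u v
    using walk_from_one[OF uv(1)] walk_from_one[OF uv(2)] is_walk_rev is_walk_append by metis
  then show ?thesis unfolding connected_sgraph_def by auto
qed

lemma S_length_eq_1_iff:
  assumes "g \<in> carrier G"
  shows "S_length g = 1 \<longleftrightarrow> g \<in> S"
proof -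
  obtain p where "is_walk \<Gamma> \<one> p g" using walk_from_one[OF assms] by blast
  from graph_dist_eq_1_iff[OF this] show ?thesis
    using assms one_notin_S edge_Cay_iff[of \<one> g] by (auto simp: S_length_def)
qed

end


section \<open>Generalized dicyclic groups\<close>

locale finite_dicyclic = finite_comm_group A for A (structure) +
  fixes y :: 'a
  assumes y: "y \<in> carrier A" and ord_y: "ord y = 2"
begin

abbreviation D where "D \<equiv> Dic A y"
abbreviation emb where "emb \<equiv> dic_emb A y"
abbreviation xemb where "xemb a \<equiv> dic_x A y \<otimes>\<^bsub>D\<^esub> emb a"

sublocale D: group D by (rule Dic_is_group)

sublocale emb: group_hom A D emb
  by unfold_locales (rule dic_emb_hom[OF is_group])

lemma y_square: "y \<otimes> y = \<one>"
  using pow_ord_eq_1[OF y] y by (simp add: ord_y numeral_2_eq_2)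

lemma inv_y: "inv y = y"
  using y y_square by (simp add: inv_equality)

lemma y_y_mult: "a \<in> carrier A \<Longrightarrow> y \<otimes> (y \<otimes> a) = a"
  using y y_square by (simp add: m_assoc[symmetric])

lemma pow_odd_y:
  assumes "odd k"
  shows "y [^] (k::nat) = y"
proof -
  obtain j where k: "k = ord y * j + 1" using assms by (auto elim!: oddE simp: ord_y)
  show ?thesis
    unfolding k nat_pow_mult[OF y, symmetric] nat_pow_pow[OF y, symmetric] using y by simp
qed

lemma two_dvd_order: "2 dvd Coset.order A"
  using ord_dvd_group_order[OF y] by (simp add: ord_y)

text \<open>The conjugation relation for \<open>inv a\<close>, solved for \<open>emb a\<close>.
  Moving \<open>x\<close> to the front is what brings products to normal form.\<close>

lemma emb_mult_x: "a \<in> carrier A \<Longrightarrow> emb a \<otimes>\<^bsub>D\<^esub> dic_x A y = xemb (inv a)"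
proof -
  assume a: "a \<in> carrier A"
  have "xemb (inv a) \<otimes>\<^bsub>D\<^esub> inv\<^bsub>D\<^esub> dic_x A y = emb a"
    using dic_x_conj[OF is_group, of "inv a" y] a by simp
  then have "emb a \<otimes>\<^bsub>D\<^esub> dic_x A y = xemb (inv a) \<otimes>\<^bsub>D\<^esub> inv\<^bsub>D\<^esub> dic_x A y \<otimes>\<^bsub>D\<^esub> dic_x A y"
    by simp
  also have "\<dots> = xemb (inv a)"
    using a dic_x_closed[of A y] by (simp add: D.m_assoc del: emb.hom_inv)
  finally show ?thesis .
qed

lemma xemb_closed [simp]: "a \<in> carrier A \<Longrightarrow> xemb a \<in> carrier D"
  using dic_x_closed[of A y] by simp

lemma emb_emb: "a \<in> carrier A \<Longrightarrow> b \<in> carrier A \<Longrightarrow> emb a \<otimes>\<^bsub>D\<^esub> emb b = emb (a \<otimes> b)"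
  by simp

lemma xemb_emb: "a \<in> carrier A \<Longrightarrow> b \<in> carrier A \<Longrightarrow> xemb a \<otimes>\<^bsub>D\<^esub> emb b = xemb (a \<otimes> b)"
  using dic_x_closed[of A y] by (simp add: D.m_assoc)

lemma emb_xemb:
  assumes "a \<in> carrier A" "b \<in> carrier A"
  shows "emb a \<otimes>\<^bsub>D\<^esub> xemb b = xemb (inv a \<otimes> b)"
proof -
  have "emb a \<otimes>\<^bsub>D\<^esub> xemb b = emb a \<otimes>\<^bsub>D\<^esub> dic_x A y \<otimes>\<^bsub>D\<^esub> emb b"
    using assms dic_x_closed[of A y] by (simp add: D.m_assoc)
  also have "\<dots> = xemb (inv a \<otimes> b)"
    unfolding emb_mult_x[OF assms(1)] using assms by (intro xemb_emb) auto
  finally show ?thesis .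
qed

lemma xemb_xemb:
  assumes "a \<in> carrier A" "b \<in> carrier A"
  shows "xemb a \<otimes>\<^bsub>D\<^esub> xemb b = emb (y \<otimes> (inv a \<otimes> b))"
proof -
  have "xemb a \<otimes>\<^bsub>D\<^esub> xemb b = dic_x A y \<otimes>\<^bsub>D\<^esub> (emb a \<otimes>\<^bsub>D\<^esub> xemb b)"
    using assms dic_x_closed[of A y] by (simp add: D.m_assoc)
  also have "\<dots> = dic_x A y \<otimes>\<^bsub>D\<^esub> dic_x A y \<otimes>\<^bsub>D\<^esub> emb (inv a \<otimes> b)"
    unfolding emb_xemb[OF assms] using assms dic_x_closed[of A y] by (simp add: D.m_assoc)
  also have "\<dots> = emb (y \<otimes> (inv a \<otimes> b))"
    unfolding dic_x_square[OF y] using assms y by (intro emb_emb) auto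
  finally show ?thesis .
qed

text \<open>On the coset of \<open>x\<close>, group inversion acts as multiplication by
  \<open>y\<close>. Symmetry of \<open>S\<close> therefore makes \<open>S2\<close> invariant under
  \<open>y\<close>, which is different from invariance under inversion in \<open>A\<close>.\<close>

lemma inv_xemb:
  assumes "a \<in> carrier A"
  shows "inv\<^bsub>D\<^esub> (xemb a) = xemb (y \<otimes> a)"
proof (rule D.inv_equality)
  have "y \<otimes> (inv (y \<otimes> a) \<otimes> a) = \<one>"
    using assms y by (simp add: inv_mult inv_y m_assoc y_square)
  then show "xemb (y \<otimes> a) \<otimes>\<^bsub>D\<^esub> xemb a = \<one>\<^bsub>D\<^esub>"
    using assms y by (simp add: xemb_xemb del: emb.hom_mult)
qed (use assms y in \<open>auto intro!: xemb_closed simp del: emb.hom_mult\<close>)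

lemma emb_eq_iff: "a \<in> carrier A \<Longrightarrow> b \<in> carrier A \<Longrightarrow> emb a = emb b \<longleftrightarrow> a = b"
  using dic_emb_inj[OF comm_group_axioms y y_square] by (auto dest: inj_onD)

lemma xemb_eq_iff: "a \<in> carrier A \<Longrightarrow> b \<in> carrier A \<Longrightarrow> xemb a = xemb b \<longleftrightarrow> a = b"
  using dic_x_closed[of A y] by (simp add: emb_eq_iff)

lemma xemb_neq_emb:
  assumes "a \<in> carrier A" "b \<in> carrier A"
  shows "xemb a \<noteq> emb b"
proof
  assume eq: "xemb a = emb b"
  have "dic_x A y = xemb a \<otimes>\<^bsub>D\<^esub> emb (inv a)"
    using assms dic_x_closed[of A y] by (simp add: D.m_assoc)
  also have "\<dots> = emb (b \<otimes> inv a)" unfolding eq using assms by (intro emb_emb) auto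
  finally show False
    using dic_x_notin[OF comm_group_axioms y y_square] assms by blast
qed

lemma carrier_D: "carrier D = emb ` carrier A \<union> xemb ` carrier A"
  unfolding Dic_carrier[OF comm_group_axioms y y_square] by (auto simp: l_coset_def)

lemma carrier_D_cases:
  assumes "g \<in> carrier D"
  obtains a where "a \<in> carrier A" "g = emb a" | a where "a \<in> carrier A" "g = xemb a"
  using assms unfolding carrier_D by blast

lemma finite_carrier_D: "finite (carrier D)"
  by (simp add: carrier_D)

lemma sum_carrier_D:
  "(\<Sum>g\<in>carrier D. f g) = (\<Sum>a\<in>carrier A. f (emb a)) + (\<Sum>a\<in>carrier A. f (xemb a))"
proof -
  have "(\<Sum>g\<in>carrier D. f g) = (\<Sum>g\<in>emb ` carrier A. f g) + (\<Sum>g\<in>xemb ` carrier A. f g)"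
    unfolding carrier_D by (rule sum.union_disjoint) (auto dest: xemb_neq_emb[symmetric])
  moreover have "inj_on emb (carrier A)" "inj_on xemb (carrier A)"
    by (auto simp: inj_on_def emb_eq_iff xemb_eq_iff)
  ultimately show ?thesis by (simp add: sum.reindex)
qed

text \<open>The order of \<open>A\<close> is even, so \<open>k\<close> is odd and the \<open>k\<close>-th power fixes \<open>y\<close>; this is what
  makes the extension of the power map by \<open>x \<mapsto> x\<close> multiplicative.\<close>

lemma power_automorphism:
  assumes k: "coprime k (Coset.order A)"
  obtains \<phi> where "\<phi> \<in> hom D D" "bij_betw \<phi> (carrier D) (carrier D)"
    "\<And>a. a \<in> carrier A \<Longrightarrow> \<phi> (emb a) = emb (a [^] (k::nat))"
    "\<And>a. a \<in> carrier A \<Longrightarrow> \<phi> (xemb a) = xemb (a [^] k)"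
proof -
  \<comment> \<open>Both descriptions are well defined because normal forms are unique.\<close>
  define \<phi> where "\<phi> = (\<lambda>g. if g \<in> emb ` carrier A
    then emb ((THE a. a \<in> carrier A \<and> g = emb a) [^] k)
    else xemb ((THE a. a \<in> carrier A \<and> g = xemb a) [^] k))"
  have \<phi>e: "\<phi> (emb a) = emb (a [^] k)" if a: "a \<in> carrier A" for a
  proof -
    have "(THE b. b \<in> carrier A \<and> emb a = emb b) = a"
      using a by (intro the_equality) (auto simp: emb_eq_iff)
    then show ?thesis using a by (simp add: \<phi>_def)
  qed
  have \<phi>x: "\<phi> (xemb a) = xemb (a [^] k)" if a: "a \<in> carrier A" for a
  proof -
    have "(THE b. b \<in> carrier A \<and> xemb a = xemb b) = a"
      using a by (intro the_equality) (auto simp: xemb_eq_iff)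
    moreover have "xemb a \<notin> emb ` carrier A" using a xemb_neq_emb by auto
    ultimately show ?thesis by (simp add: \<phi>_def)
  qed
  have "odd k" using k two_dvd_order by (meson coprime_common_divisor odd_one)
  then have yk: "y [^] k = y" by (rule pow_odd_y)
  have pw: "(inv a) [^] k = inv (a [^] k)" "(a \<otimes> b) [^] k = a [^] k \<otimes> b [^] k"
    if "a \<in> carrier A" "b \<in> carrier A" for a b
    using that by (simp_all add: pow_mult_distrib m_comm nat_pow_inv)
  note pw = pw(1)[OF _ one_closed] pw(2)
  have closed: "\<phi> g \<in> carrier D" if "g \<in> carrier D" for g
    using that by (elim carrier_D_cases) (auto simp: \<phi>e \<phi>x simp del: emb.hom_nat_pow)
  have "\<phi> \<in> hom D D"
  proof (rule homI)
    fix g h assume g: "g \<in> carrier D" and h: "h \<in> carrier D"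
    show "\<phi> (g \<otimes>\<^bsub>D\<^esub> h) = \<phi> g \<otimes>\<^bsub>D\<^esub> \<phi> h"
    proof (cases rule: carrier_D_cases[OF g]; cases rule: carrier_D_cases[OF h])
      fix a b assume ab: "a \<in> carrier A" "b \<in> carrier A" "g = emb a" "h = emb b"
      show ?thesis unfolding ab(3,4) emb_emb[OF ab(1,2)]
        using ab(1,2) by (simp only: \<phi>e emb_emb m_closed nat_pow_closed pw)
    next
      fix a b assume ab: "a \<in> carrier A" "b \<in> carrier A" "g = emb a" "h = xemb b"
      show ?thesis unfolding ab(3,4) emb_xemb[OF ab(1,2)]
        using ab(1,2) by (simp only: \<phi>e \<phi>x emb_xemb m_closed inv_closed nat_pow_closed pw)
    next
      fix a b assume ab: "a \<in> carrier A" "b \<in> carrier A" "g = xemb a" "h = emb b"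
      show ?thesis unfolding ab(3,4) xemb_emb[OF ab(1,2)]
        using ab(1,2) by (simp only: \<phi>e \<phi>x xemb_emb m_closed nat_pow_closed pw)
    next
      fix a b assume ab: "a \<in> carrier A" "b \<in> carrier A" "g = xemb a" "h = xemb b"
      show ?thesis unfolding ab(3,4) xemb_xemb[OF ab(1,2)]
        using ab(1,2) y by (simp only: \<phi>e \<phi>x xemb_xemb m_closed inv_closed nat_pow_closed pw yk)
    qed
  qed (rule closed)
  moreover have "inj_on \<phi> (carrier D)"
  proof (rule inj_onI)
    fix g h assume g: "g \<in> carrier D" and h: "h \<in> carrier D" and eq: "\<phi> g = \<phi> h"
    show "g = h"
    proof (cases rule: carrier_D_cases[OF g]; cases rule: carrier_D_cases[OF h])
      fix a b assume ab: "a \<in> carrier A" "b \<in> carrier A" "g = emb a" "h = emb b"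
      then show ?thesis using eq pow_inj_coprime[OF k ab(1,2)]
        by (simp only: \<phi>e emb_eq_iff nat_pow_closed)
    next
      fix a b assume ab: "a \<in> carrier A" "b \<in> carrier A" "g = emb a" "h = xemb b"
      then show ?thesis using eq xemb_neq_emb[of "b [^] k" "a [^] k"]
        by (metis \<phi>e \<phi>x nat_pow_closed)
    next
      fix a b assume ab: "a \<in> carrier A" "b \<in> carrier A" "g = xemb a" "h = emb b"
      then show ?thesis using eq xemb_neq_emb[of "a [^] k" "b [^] k"]
        by (metis \<phi>e \<phi>x nat_pow_closed)
    next
      fix a b assume ab: "a \<in> carrier A" "b \<in> carrier A" "g = xemb a" "h = xemb b"
      then show ?thesis using eq pow_inj_coprime[OF k ab(1,2)]
        by (simp only: \<phi>x xemb_eq_iff nat_pow_closed)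
    qed
  qed
  then have "bij_betw \<phi> (carrier D) (carrier D)"
    using closed finite_carrier_D endo_inj_surj[of "carrier D" \<phi>] by (auto simp: bij_betw_def)
  ultimately show ?thesis using \<phi>e \<phi>x that by blast
qed

section \<open>Reduction of the spectrum from the dicyclic group to \<open>A\<close>\<close>

text \<open>Values of \<open>H\<close> on the coset of \<open>x\<close> meet the kernel
  \<open>f (b \<otimes> a)\<close>. Reindexing by inversion and evenness of \<open>f\<close> make it
  a convolution kernel, at the price of inverting the argument of \<open>h\<close>.\<close>

lemma sum_shift_inv:
  fixes f :: "'a \<Rightarrow> int" and h :: "'a \<Rightarrow> complex"
  assumes f: "\<And>a. a \<in> carrier A \<Longrightarrow> f (inv a) = f a" and b: "b \<in> carrier A"
  shows "(\<Sum>a\<in>carrier A. of_int (f (b \<otimes> a)) * h a)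
    = (\<Sum>a\<in>carrier A. of_int (f (inv b \<otimes> a)) * h (inv a))"
proof -
  have "f (b \<otimes> inv a) = f (inv b \<otimes> a)" if a: "a \<in> carrier A" for a
    using f[of "b \<otimes> inv a"] a b by (simp add: inv_mult)
  then show ?thesis
    by (subst sum_inv[symmetric]) (auto intro: sum.cong)
qed

text \<open>Since \<open>f\<^sub>1\<close> and \<open>f\<^sub>2\<close> are even, convolution by \<open>F = f\<^sub>1 + x f\<^sub>2\<close> acts on a pair
  \<open>(h, k)\<close>, where \<open>k a = H (x a\<^sup>-\<^sup>1)\<close>, by the symmetric matrix with entries \<open>f\<^sub>1, f\<^sub>2\<close>, which is
  diagonalised by \<open>h \<plusminus> k\<close>.\<close>

lemma conv_eigenvalue_D_iff:
  assumes f1: "\<And>a. a \<in> carrier A \<Longrightarrow> F (emb (inv a)) = F (emb a)"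
    and f2: "\<And>a. a \<in> carrier A \<Longrightarrow> F (xemb (inv a)) = F (xemb a)"
    and f2y: "\<And>a. a \<in> carrier A \<Longrightarrow> F (xemb (y \<otimes> a)) = F (xemb a)"
  shows "D.conv_eigenvalue F l \<longleftrightarrow>
    conv_eigenvalue (\<lambda>a. F (emb a) + F (xemb a)) l \<or> conv_eigenvalue (\<lambda>a. F (emb a) - F (xemb a)) l"
proof -
  define C where "C = (\<lambda>f h b. \<Sum>a\<in>carrier A. of_int (f (inv b \<otimes> a) :: int) * (h a :: complex))"
  define f1' where "f1' a = F (emb a)" for a
  define f2' where "f2' a = F (xemb a)" for a
  have row1: "(\<Sum>v\<in>carrier D. of_int (F (inv\<^bsub>D\<^esub> (emb b) \<otimes>\<^bsub>D\<^esub> v)) * H v)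
      = C f1' (\<lambda>a. H (emb a)) b + C f2' (\<lambda>a. H (xemb (inv a))) b"
    if b: "b \<in> carrier A" for b H
  proof -
    have "inv\<^bsub>D\<^esub> (emb b) \<otimes>\<^bsub>D\<^esub> emb a = emb (inv b \<otimes> a)"
      "inv\<^bsub>D\<^esub> (emb b) \<otimes>\<^bsub>D\<^esub> xemb a = xemb (b \<otimes> a)" if "a \<in> carrier A" for a
      using that b emb_emb[of "inv b" a] emb_xemb[of "inv b" a] by simp_all
    then have "(\<Sum>v\<in>carrier D. of_int (F (inv\<^bsub>D\<^esub> (emb b) \<otimes>\<^bsub>D\<^esub> v)) * H v)
        = (\<Sum>a\<in>carrier A. of_int (f1' (inv b \<otimes> a)) * H (emb a))
          + (\<Sum>a\<in>carrier A. of_int (f2' (b \<otimes> a)) * H (xemb a))"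
      unfolding sum_carrier_D f1'_def f2'_def
      by (intro arg_cong2[where f = "(+)"] sum.cong) simp_all
    then show ?thesis
      unfolding C_def using sum_shift_inv[of f2' b "\<lambda>a. H (xemb a)"] f2 b by (simp add: f2'_def)
  qed
  \<comment> \<open>The rows on the coset of \<open>x\<close> are indexed by
    \<open>xemb (inv b)\<close> to match the inverted argument in the columns. The factor
    \<open>y\<close> from group inversion is absorbed by \<open>f2y\<close>.\<close>
  have row2: "(\<Sum>v\<in>carrier D. of_int (F (inv\<^bsub>D\<^esub> (xemb (inv b)) \<otimes>\<^bsub>D\<^esub> v)) * H v)
      = C f2' (\<lambda>a. H (emb a)) b + C f1' (\<lambda>a. H (xemb (inv a))) b"
    if b: "b \<in> carrier A" for b H
  proof -
    have e: "inv\<^bsub>D\<^esub> (xemb (inv b)) \<otimes>\<^bsub>D\<^esub> emb a = xemb (y \<otimes> (inv b \<otimes> a))"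
      "inv\<^bsub>D\<^esub> (xemb (inv b)) \<otimes>\<^bsub>D\<^esub> xemb a = emb (b \<otimes> a)" if a: "a \<in> carrier A" for a
    proof -
      have "inv\<^bsub>D\<^esub> (xemb (inv b)) = xemb (y \<otimes> inv b)" using b by (intro inv_xemb) simp
      moreover have "y \<otimes> (inv (y \<otimes> inv b) \<otimes> a) = b \<otimes> a"
        using a b y by (simp add: inv_mult inv_y m_assoc y_y_mult)
      ultimately show "inv\<^bsub>D\<^esub> (xemb (inv b)) \<otimes>\<^bsub>D\<^esub> emb a = xemb (y \<otimes> (inv b \<otimes> a))"
        "inv\<^bsub>D\<^esub> (xemb (inv b)) \<otimes>\<^bsub>D\<^esub> xemb a = emb (b \<otimes> a)"
        using xemb_emb[of "y \<otimes> inv b" a] xemb_xemb[of "y \<otimes> inv b" a] a b y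
        by (simp_all add: m_assoc del: emb.hom_mult emb.hom_inv)
    qed
    have "F (xemb (y \<otimes> (inv b \<otimes> a))) = f2' (inv b \<otimes> a)" if "a \<in> carrier A" for a
      unfolding f2'_def using that b by (intro f2y) simp
    then have "(\<Sum>v\<in>carrier D. of_int (F (inv\<^bsub>D\<^esub> (xemb (inv b)) \<otimes>\<^bsub>D\<^esub> v)) * H v)
        = (\<Sum>a\<in>carrier A. of_int (f2' (inv b \<otimes> a)) * H (emb a))
          + (\<Sum>a\<in>carrier A. of_int (f1' (b \<otimes> a)) * H (xemb a))"
      unfolding sum_carrier_D f1'_def
      by (intro arg_cong2[where f = "(+)"] sum.cong) (simp_all only: e)
    then show ?thesis
      unfolding C_def using sum_shift_inv[of f1' b "\<lambda>a. H (xemb a)"] f1 b by (simp add: f1'_def)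
  qed
  define sys where "sys = (\<lambda>h k. \<forall>b\<in>carrier A.
    C f1' h b + C f2' k b = l * h b \<and> C f2' h b + C f1' k b = l * k b)"
  have all_D: "(\<forall>g\<in>carrier D. P g) \<longleftrightarrow> (\<forall>a\<in>carrier A. P (emb a) \<and> P (xemb (inv a)))" for P
    unfolding carrier_D by (auto simp del: emb.hom_inv) (metis inv_closed inv_inv)
  have sys: "(\<forall>u\<in>carrier D. (\<Sum>v\<in>carrier D. of_int (F (inv\<^bsub>D\<^esub> u \<otimes>\<^bsub>D\<^esub> v)) * H v) = l * H u)
      \<longleftrightarrow> sys (\<lambda>a. H (emb a)) (\<lambda>a. H (xemb (inv a)))" for H
    unfolding all_D sys_def using row1 row2 by (simp del: emb.hom_inv)
  have C_add: "C (\<lambda>a. f a + f' a) h b = C f h b + C f' h b"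
    and C_diff: "C (\<lambda>a. f a - f' a) h b = C f h b - C f' h b"
    and C_add2: "C f (\<lambda>a. h a + k a) b = C f h b + C f k b"
    and C_diff2: "C f (\<lambda>a. h a - k a) b = C f h b - C f k b"
    and C_neg: "C f (\<lambda>a. - h a) b = - C f h b" for f f' h k b
    by (simp_all add: C_def algebra_simps sum.distrib sum_subtractf sum_negf)
  have conv: "conv_eigenvalue f l \<longleftrightarrow>
      (\<exists>h. (\<exists>a\<in>carrier A. h a \<noteq> 0) \<and> (\<forall>b\<in>carrier A. C f h b = l * h b))" for f
    by (simp add: conv_eigenvalue_def C_def)
  show ?thesis
    unfolding f1'_def[symmetric] f2'_def[symmetric]
  proof
    assume "D.conv_eigenvalue F l"
    then obtain H where nz: "\<not> (\<forall>g\<in>carrier D. H g = 0)"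
      and s: "sys (\<lambda>a. H (emb a)) (\<lambda>a. H (xemb (inv a)))"
      unfolding D.conv_eigenvalue_def sys by blast
    define h where "h = (\<lambda>a. H (emb a))"
    define k where "k = (\<lambda>a. H (xemb (inv a)))"
    have hk: "\<not> (\<forall>a\<in>carrier A. h a = 0 \<and> k a = 0)"
      using nz unfolding all_D h_def k_def .
    have s: "C f1' h b + C f2' k b = l * h b" "C f2' h b + C f1' k b = l * k b"
      if "b \<in> carrier A" for b
      using s that unfolding sys_def h_def k_def by blast+
    show "conv_eigenvalue (\<lambda>a. f1' a + f2' a) l \<or> conv_eigenvalue (\<lambda>a. f1' a - f2' a) l"
    \<comment> \<open>For a nonzero pair, \<open>h + k\<close> and \<open>h - k\<close> cannot both
      vanish; whichever survives is an eigenvector on \<open>A\<close>.\<close>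
    proof (cases "\<exists>a\<in>carrier A. h a + k a \<noteq> 0")
      case True
      have "C (\<lambda>a. f1' a + f2' a) (\<lambda>a. h a + k a) b = l * (h b + k b)" if "b \<in> carrier A" for b
      proof -
        have "C (\<lambda>a. f1' a + f2' a) (\<lambda>a. h a + k a) b
            = (C f1' h b + C f2' k b) + (C f2' h b + C f1' k b)"
          by (simp add: C_add C_add2)
        then show ?thesis unfolding s[OF that] by (simp add: distrib_left)
      qed
      with True have "conv_eigenvalue (\<lambda>a. f1' a + f2' a) l"
        unfolding conv by (intro exI[of _ "\<lambda>a. h a + k a"]) auto
      then show ?thesis ..
    next
      case False
      then have "\<exists>a\<in>carrier A. h a - k a \<noteq> 0"
        using hk by (auto simp: add_eq_0_iff2)
      moreover have "C (\<lambda>a. f1' a - f2' a) (\<lambda>a. h a - k a) b = l * (h b - k b)"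
        if "b \<in> carrier A" for b
      proof -
        have "C (\<lambda>a. f1' a - f2' a) (\<lambda>a. h a - k a) b
            = (C f1' h b + C f2' k b) - (C f2' h b + C f1' k b)"
          by (simp add: C_diff C_diff2)
        then show ?thesis unfolding s[OF that] by (simp add: right_diff_distrib)
      qed
      ultimately have "conv_eigenvalue (\<lambda>a. f1' a - f2' a) l"
        unfolding conv by (intro exI[of _ "\<lambda>a. h a - k a"]) auto
      then show ?thesis ..
    qed
  next
    \<comment> \<open>Conversely, a solution \<open>(h, k)\<close> of the block system is glued to a
      function \<open>H\<close> along the normal forms, and \<open>a\<close> shows that
      \<open>H\<close> is nonzero.\<close>
    have D_eig: "D.conv_eigenvalue F l"
      if s: "sys h k" and a: "a \<in> carrier A" "h a \<noteq> 0" for h k a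
    proof -
      define H where "H = (\<lambda>g. if g \<in> emb ` carrier A
        then h (THE a. a \<in> carrier A \<and> g = emb a) else k (inv (THE a. a \<in> carrier A \<and> g = xemb a)))"
      have He: "H (emb a) = h a" if a: "a \<in> carrier A" for a
      proof -
        have "(THE b. b \<in> carrier A \<and> emb a = emb b) = a"
          using a by (intro the_equality) (auto simp: emb_eq_iff)
        then show ?thesis using a by (simp add: H_def)
      qed
      have Hx: "H (xemb (inv a)) = k a" if a: "a \<in> carrier A" for a
      proof -
        have "(THE b. b \<in> carrier A \<and> xemb (inv a) = xemb b) = inv a"
          using a by (intro the_equality) (auto simp: xemb_eq_iff simp del: emb.hom_inv)
        moreover have "xemb (inv a) \<notin> emb ` carrier A"
          using a xemb_neq_emb[of "inv a"] by (auto simp del: emb.hom_inv)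
        ultimately show ?thesis using a by (simp add: H_def del: emb.hom_inv)
      qed
      have "C f (\<lambda>a. H (emb a)) b = C f h b" "C f (\<lambda>a. H (xemb (inv a))) b = C f k b" for f b
        unfolding C_def by (intro sum.cong HOL.refl; simp add: He Hx del: emb.hom_inv)+
      then have "sys (\<lambda>a. H (emb a)) (\<lambda>a. H (xemb (inv a)))"
        using s He Hx unfolding sys_def by (simp del: emb.hom_inv)
      moreover have "H (emb a) \<noteq> 0" "emb a \<in> carrier D" using a He by auto
      ultimately show ?thesis unfolding D.conv_eigenvalue_def sys[symmetric] by blast
    qed
    assume "conv_eigenvalue (\<lambda>a. f1' a + f2' a) l \<or> conv_eigenvalue (\<lambda>a. f1' a - f2' a) l"
    then show "D.conv_eigenvalue F l"
    proof
      assume "conv_eigenvalue (\<lambda>a. f1' a + f2' a) l"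
      then obtain h a where h: "a \<in> carrier A" "h a \<noteq> 0"
        "\<And>b. b \<in> carrier A \<Longrightarrow> C (\<lambda>a. f1' a + f2' a) h b = l * h b"
        unfolding conv by blast
      \<comment> \<open>The pair \<open>(h, h)\<close> lifts an eigenvector of the sum; the pair
        \<open>(h, - h)\<close> does the same for the difference below.\<close>
      have "sys h h" unfolding sys_def using h(3) by (simp add: C_add add.commute)
      then show ?thesis using D_eig h by blast
    next
      assume "conv_eigenvalue (\<lambda>a. f1' a - f2' a) l"
      then obtain h a where h: "a \<in> carrier A" "h a \<noteq> 0"
        "\<And>b. b \<in> carrier A \<Longrightarrow> C (\<lambda>a. f1' a - f2' a) h b = l * h b"
        unfolding conv by blast
      have "sys h (\<lambda>a. - h a)"
        unfolding sys_def using h(3) by (auto simp: C_diff C_neg algebra_simps)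
      then show ?thesis using D_eig h by blast
    qed
  qed
qed

text \<open>Power invariance of the sum and the difference is equivalent to that of both components:
  over the integers the two equations determine each component, and the larger of the two bounds
  serves for both.\<close>

lemma conv_eigenvalues_D_Ints_iff:
  assumes f1: "\<And>a. a \<in> carrier A \<Longrightarrow> F (emb (inv a)) = F (emb a)"
    and f2: "\<And>a. a \<in> carrier A \<Longrightarrow> F (xemb (inv a)) = F (xemb a)"
    and f2y: "\<And>a. a \<in> carrier A \<Longrightarrow> F (xemb (y \<otimes> a)) = F (xemb a)"
  shows "(\<forall>l. D.conv_eigenvalue F l \<longrightarrow> l \<in> \<int>) \<longleftrightarrow>
    (\<exists>M. \<forall>p>M. prime p \<longrightarrow>
      (\<forall>a\<in>carrier A. F (emb (a [^] (p::nat))) = F (emb a) \<and> F (xemb (a [^] p)) = F (xemb a)))"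
    (is "?L \<longleftrightarrow> ?R")
proof -
  have "?L \<longleftrightarrow> power_invariant (\<lambda>a. F (emb a) + F (xemb a)) \<and>
      power_invariant (\<lambda>a. F (emb a) - F (xemb a))"
    using conv_eigenvalue_D_iff[of F, OF assms] by (auto simp: conv_eigenvalues_Ints_iff[symmetric])
  also have "\<dots> \<longleftrightarrow> ?R"
  proof
    assume "power_invariant (\<lambda>a. F (emb a) + F (xemb a)) \<and>
      power_invariant (\<lambda>a. F (emb a) - F (xemb a))"
    then obtain M M' where
      M: "\<And>p a. p > M \<Longrightarrow> prime p \<Longrightarrow> a \<in> carrier A \<Longrightarrow>
        F (emb (a [^] (p::nat))) + F (xemb (a [^] p)) = F (emb a) + F (xemb a)"
      and M': "\<And>p a. p > M' \<Longrightarrow> prime p \<Longrightarrow> a \<in> carrier A \<Longrightarrow>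
        F (emb (a [^] (p::nat))) - F (xemb (a [^] p)) = F (emb a) - F (xemb a)"
      unfolding power_invariant_def by blast
    have "F (emb (a [^] p)) = F (emb a) \<and> F (xemb (a [^] p)) = F (xemb a)"
      if "p > max M M'" "prime p" "a \<in> carrier A" for p a
      using M[of p a] M'[of p a] that by linarith
    then show ?R by blast
  next
    assume ?R
    then show "power_invariant (\<lambda>a. F (emb a) + F (xemb a)) \<and>
      power_invariant (\<lambda>a. F (emb a) - F (xemb a))"
      unfolding power_invariant_def by metis
  qed
  finally show ?thesis .
qed

end

section \<open>Comparison of the adjacency and distance spectra\<close>

theorem theorem6p1:
  fixes A :: "('a, 'm) monoid_scheme" and y :: 'a
    and S :: "'a dic_gen gword set set" and S1 S2 :: "'a set"
  assumes "comm_group A" and "finite (carrier A)"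
    and "even (Coset.order A)" and "group_exponent A \<ge> 3"
    and "y \<in> carrier A" and "group.ord A y = 2"
    and "S \<subseteq> carrier (Dic A y)"
    and "\<one>\<^bsub>Dic A y\<^esub> \<notin> S"
    and "set_inv\<^bsub>Dic A y\<^esub> S = S"
    and "generate (Dic A y) S = carrier (Dic A y)"
    and "S1 \<subseteq> carrier A" and "S2 \<subseteq> carrier A"
    and "S = dic_emb A y ` S1 \<union> (dic_x A y <#\<^bsub>Dic A y\<^esub> (dic_emb A y ` S2))"
    and "set_inv\<^bsub>A\<^esub> S2 = S2"
  shows "distance_integral_graph (Cay (Dic A y) S) \<longleftrightarrow> integral_graph (Cay (Dic A y) S)"
proof -
  interpret A: comm_group A by fact
  interpret finite_dicyclic A y
    by unfold_locales (use assms in auto)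
  interpret cayley_graph D S
    by unfold_locales (use assms in auto)
  have mem_S: "emb a \<in> S \<longleftrightarrow> a \<in> S1" "xemb a \<in> S \<longleftrightarrow> a \<in> S2" if "a \<in> carrier A" for a
    using that assms(11,12) xemb_neq_emb[of a] xemb_neq_emb[OF _ that]
    unfolding assms(13) l_coset_def by (auto simp: emb_eq_iff xemb_eq_iff subset_iff) metis+
  have S1_inv: "inv\<^bsub>A\<^esub> a \<in> S1 \<longleftrightarrow> a \<in> S1" if a: "a \<in> carrier A" for a
  proof -
    have "inv\<^bsub>A\<^esub> b \<in> S1" if "b \<in> S1" for b
      using that assms(11) inv_mem_S[of "emb b"] mem_S(1)[of b] mem_S(1)[of "inv\<^bsub>A\<^esub> b"] by auto
    then show ?thesis using a A.inv_inv by metis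
  qed
  have S2_inv: "inv\<^bsub>A\<^esub> a \<in> S2 \<longleftrightarrow> a \<in> S2" if a: "a \<in> carrier A" for a
  proof -
    have "inv\<^bsub>A\<^esub> b \<in> S2" if "b \<in> S2" for b
      using that assms(14) by (auto simp: SET_INV_def)
    then show ?thesis using a A.inv_inv by metis
  qed
  have S2_y: "y \<otimes>\<^bsub>A\<^esub> a \<in> S2 \<longleftrightarrow> a \<in> S2" if a: "a \<in> carrier A" for a
  proof -
    have "y \<otimes>\<^bsub>A\<^esub> b \<in> S2" if "b \<in> S2" "b \<in> carrier A" for b
      using that inv_mem_S[of "xemb b"] mem_S(2)[of b] mem_S(2)[of "y \<otimes>\<^bsub>A\<^esub> b"] y
      by (simp add: inv_xemb del: emb.hom_mult)
    then show ?thesis using a y y_y_mult by (metis A.m_closed)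
  qed
  \<comment> \<open>If the \<open>k\<close>-th power map preserves \<open>S1\<close> and
    \<open>S2\<close>, its extension fixing \<open>x\<close> is a group automorphism preserving
    \<open>S\<close>, hence word length.\<close>
  have S_length_pow: "S_length (emb (a [^]\<^bsub>A\<^esub> k)) = S_length (emb a)"
      "S_length (xemb (a [^]\<^bsub>A\<^esub> k)) = S_length (xemb a)"
    if k: "coprime k (Coset.order A)" and a: "a \<in> carrier A"
      and S12: "\<And>b. b \<in> carrier A \<Longrightarrow> b [^]\<^bsub>A\<^esub> k \<in> S1 \<longleftrightarrow> b \<in> S1"
        "\<And>b. b \<in> carrier A \<Longrightarrow> b [^]\<^bsub>A\<^esub> k \<in> S2 \<longleftrightarrow> b \<in> S2"
    for k :: nat and a
  proof -
    obtain \<phi> where \<phi>: "\<phi> \<in> hom D D" "bij_betw \<phi> (carrier D) (carrier D)"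
      "\<And>a. a \<in> carrier A \<Longrightarrow> \<phi> (emb a) = emb (a [^]\<^bsub>A\<^esub> k)"
      "\<And>a. a \<in> carrier A \<Longrightarrow> \<phi> (xemb a) = xemb (a [^]\<^bsub>A\<^esub> k)"
      using power_automorphism[OF k] by blast
    have "\<phi> g \<in> S \<longleftrightarrow> g \<in> S" if "g \<in> carrier D" for g
      using that by (cases rule: carrier_D_cases)
        (simp_all add: \<phi>(3,4) mem_S S12 del: emb.hom_nat_pow)
    note len = S_length_automorphism[OF \<phi>(1,2) this]
    show "S_length (emb (a [^]\<^bsub>A\<^esub> k)) = S_length (emb a)"
      "S_length (xemb (a [^]\<^bsub>A\<^esub> k)) = S_length (xemb a)"
      using len[of "emb a"] len[of "xemb a"] a by (simp_all add: \<phi>(3,4) del: emb.hom_nat_pow)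
  qed
  \<comment> \<open>Inversion on \<open>A\<close> is the power map with exponent one less than the
    order. As this exponent is coprime to the order, evenness of \<open>S1\<close> and
    \<open>S2\<close> passes to word length on the coset of \<open>x\<close>.\<close>
  define inv_exp where "inv_exp = Coset.order A - 1"
  have ord2: "Coset.order A \<ge> 2"
    using two_dvd_order A.order_gt_0_iff_finite assms(2) by (auto intro!: dvd_imp_le)
  have inv_exp: "coprime inv_exp (Coset.order A)" "a [^]\<^bsub>A\<^esub> inv_exp = inv\<^bsub>A\<^esub> a" if "a \<in> carrier A" for a
  proof -
    show "coprime inv_exp (Coset.order A)"
      unfolding inv_exp_def using ord2 by (intro coprime_diff_one_left_nat) simp
    have "a [^]\<^bsub>A\<^esub> inv_exp \<otimes>\<^bsub>A\<^esub> a = a [^]\<^bsub>A\<^esub> (Suc inv_exp)" by simp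
    also have "\<dots> = \<one>\<^bsub>A\<^esub>"
      using ord2 A.pow_order_eq_1[OF that] by (simp add: inv_exp_def del: A.nat_pow_Suc)
    finally show "a [^]\<^bsub>A\<^esub> inv_exp = inv\<^bsub>A\<^esub> a" using that A.inv_equality[of _ a] by simp
  qed
  have adj: "integral_graph \<Gamma> \<longleftrightarrow> (\<forall>l. D.conv_eigenvalue (\<lambda>g. of_bool (g \<in> S)) l \<longrightarrow> l \<in> \<int>)"
    unfolding integral_graph_def adjacency_matrix_def vertices_Cay
      eigenvalue_matrix_on[OF finite_carrier_D] D.conv_eigenvalue_def
    by (simp add: edge_Cay_iff of_bool_def if_distrib[of complex_of_int] cong: if_cong)
  have dist: "distance_integral_graph \<Gamma> \<longleftrightarrow>
      (\<forall>l. D.conv_eigenvalue (\<lambda>g. int (S_length g)) l \<longrightarrow> l \<in> \<int>)"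
    unfolding distance_integral_graph_def distance_matrix_def vertices_Cay
      eigenvalue_matrix_on[OF finite_carrier_D] D.conv_eigenvalue_def
    by (simp add: graph_dist_eq_S_length connected_Cay)
  have adj_iff: "integral_graph \<Gamma> \<longleftrightarrow> (\<exists>M. \<forall>p>M. prime p \<longrightarrow> (\<forall>a\<in>carrier A.
      (a [^]\<^bsub>A\<^esub> (p::nat) \<in> S1 \<longleftrightarrow> a \<in> S1) \<and> (a [^]\<^bsub>A\<^esub> p \<in> S2 \<longleftrightarrow> a \<in> S2)))"
    unfolding adj
    by (subst conv_eigenvalues_D_Ints_iff)
      (auto simp: mem_S S1_inv S2_inv S2_y y simp del: emb.hom_inv emb.hom_mult emb.hom_nat_pow)
  have dist_iff: "distance_integral_graph \<Gamma> \<longleftrightarrow> (\<exists>M. \<forall>p>M. prime p \<longrightarrow> (\<forall>a\<in>carrier A.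
      S_length (emb (a [^]\<^bsub>A\<^esub> (p::nat))) = S_length (emb a) \<and>
      S_length (xemb (a [^]\<^bsub>A\<^esub> p)) = S_length (xemb a)))"
    unfolding dist
  proof (subst conv_eigenvalues_D_Ints_iff)
    \<comment> \<open>Inversion in the dicyclic group gives evenness on \<open>A\<close> and
      invariance under \<open>y\<close> on the coset of \<open>x\<close>. Evenness on that coset is
      the case of the power automorphism with exponent \<open>inv_exp\<close>.\<close>
    fix a assume a: "a \<in> carrier A"
    show "int (S_length (emb (inv\<^bsub>A\<^esub> a))) = int (S_length (emb a))"
      using S_length_inv[of "emb a"] a by simp
    show "int (S_length (xemb (inv\<^bsub>A\<^esub> a))) = int (S_length (xemb a))"
      using S_length_pow(2)[OF inv_exp(1)[OF a] a] inv_exp(2) S1_inv S2_inv a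
      by (simp del: emb.hom_inv)
    show "int (S_length (xemb (y \<otimes>\<^bsub>A\<^esub> a))) = int (S_length (xemb a))"
      using S_length_inv[of "xemb a"] a by (simp add: inv_xemb del: emb.hom_mult)
  qed simp
  have "distance_integral_graph \<Gamma> \<longleftrightarrow> integral_graph \<Gamma>"
  proof
    assume "integral_graph \<Gamma>"
    then obtain M where M: "\<And>p a. p > M \<Longrightarrow> prime p \<Longrightarrow> a \<in> carrier A \<Longrightarrow>
      (a [^]\<^bsub>A\<^esub> (p::nat) \<in> S1 \<longleftrightarrow> a \<in> S1) \<and> (a [^]\<^bsub>A\<^esub> p \<in> S2 \<longleftrightarrow> a \<in> S2)"
      unfolding adj_iff by blast
    have "S_length (emb (a [^]\<^bsub>A\<^esub> p)) = S_length (emb a) \<and>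
      S_length (xemb (a [^]\<^bsub>A\<^esub> p)) = S_length (xemb a)"
      if p: "p > max M (Coset.order A)" "prime p" and a: "a \<in> carrier A" for p a
    proof -
      \<comment> \<open>A prime above the group order is coprime to it, so the power automorphism
        exists.\<close>
      have "coprime p (Coset.order A)"
        using p ord2 by (intro prime_imp_coprime) (auto dest: dvd_imp_le)
      with S_length_pow[of p a] M[of p] p a show ?thesis by auto
    qed
    then show "distance_integral_graph \<Gamma>" unfolding dist_iff by blast
  next
    assume "distance_integral_graph \<Gamma>"
    then obtain M where M: "\<And>p a. p > M \<Longrightarrow> prime p \<Longrightarrow> a \<in> carrier A \<Longrightarrow>
      S_length (emb (a [^]\<^bsub>A\<^esub> (p::nat))) = S_length (emb a) \<and>
      S_length (xemb (a [^]\<^bsub>A\<^esub> p)) = S_length (xemb a)"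
      unfolding dist_iff by blast
    \<comment> \<open>\<open>S\<close> is the level set of word length at 1, so invariance of the
      length forces invariance of \<open>S1\<close> and \<open>S2\<close>.\<close>
    have S12: "a \<in> S1 \<longleftrightarrow> S_length (emb a) = 1" "a \<in> S2 \<longleftrightarrow> S_length (xemb a) = 1"
      if "a \<in> carrier A" for a
      using that mem_S[OF that] S_length_eq_1_iff[of "emb a"] S_length_eq_1_iff[of "xemb a"] by auto
    have "(a [^]\<^bsub>A\<^esub> p \<in> S1 \<longleftrightarrow> a \<in> S1) \<and> (a [^]\<^bsub>A\<^esub> p \<in> S2 \<longleftrightarrow> a \<in> S2)"
      if "p > M" "prime p" "a \<in> carrier A" for p a
      using M[OF that] that(3) by (simp add: S12 del: emb.hom_nat_pow)
    then show "integral_graph \<Gamma>" unfolding adj_iff by blast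
  qed
  then show ?thesis .
qed

end
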